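(* Let $\{u_n\}_{n\ge 0}$ be one of the $15$ Apéry-like sequences and let $\alpha$ be an integer. Then for all non-negative integers $n$, $$u_n\equiv \alpha^n \pmod{M_{\alpha}^{(sf)}}.$$
   Context: Apéry-like sequences of the second kind (6 sequences): the integer sequences $\{u_n\}_{n\ge0}$ determined by $u_{-1}=0$, $u_0=1$ and $$(n+1)^2u_{n+1}-(An^2+An+\lambda)u_n+Bn^2u_{n-1}=0\quad(n\ge 0),$$ with $(A,B,\lambda)$ equal to $(7,-8,2)$ [name A], $(9,27,3)$ [B], $(10,9,3)$ [C], $(11,-1,3)$ [D], $(12,32,4)$ [E], $(17,72,6)$ [F]. Apéry-like sequences of the first kind (9 sequences): the integer sequences $\{u_n\}_{n\ge0}$ determined by $u_{-1}=0$, $u_0=1$ and $$(n+1)^3u_{n+1}-(2n+1)(an^2+an+b)u_n+n(cn^2+d)u_{n-1}=0\quad(n\ge0),$$ with $(a,b,c,d)$ equal to $(7,3,81,0)$ [name $\delta$], $(11,5,125,0)$ [$\eta$], $(10,4,64,0)$ [$\alpha$], $(12,4,16,0)$ [$\epsilon$], $(9,3,-27,0)$ [$\zeta$], $(17,5,1,0)$ [$\gamma$], $(13,4,-27,3)$ [$s_7$], $(6,2,-64,4)$ [$s_{10}$], $(14,6,192,-12)$ [$s_{18}$]. It is known that all these sequences consist of integers. Together they are the $15$ Apéry-like sequences. Binomial transform: for a complex number $x$, $v_n(x)=\sum_{k=0}^n\binom{n}{k}(-x)^{n-k}u_k$ for $n\ge0$. $(n_1,\dots,n_r)$ denotes the greatest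 positive common divisor of the integers $n_1,\dots,n_r$. For an integer $\alpha$, $M_\alpha=(v_1(\alpha),v_2(\alpha),v_3(\alpha))$ if $\{u_n\}$ is of the second kind, and $M_\alpha=(v_1(\alpha),v_2(\alpha),v_3(\alpha),v_4(\alpha))$ if $\{u_n\}$ is of the first kind. For a positive integer $M$, $M^{(sf)}$ denotes the largest square-free factor (divisor) of $M$. *)

theory Defs
  imports "HOL-Number_Theory.Number_Theory" "HOL-Computational_Algebra.Squarefree"
begin

(* The index -1 is not available on type nat; the convention u_(-1) = 0 is built into prev. *)
definition prev :: "(nat \<Rightarrow> int) \<Rightarrow> nat \<Rightarrow> int" where
  "prev u n = (if n = 0 then 0 else u (n - 1))"

definition second_kind_rec :: "int \<times> int \<times> int \<Rightarrow> (nat \<Rightarrow> int) \<Rightarrow> bool" where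
  "second_kind_rec = (\<lambda>(A, B, l) u. u 0 = 1 \<and>
     (\<forall>n. (int n + 1)^2 * u (n + 1) - (A * int n ^ 2 + A * int n + l) * u n
            + B * int n ^ 2 * prev u n = 0))"

definition first_kind_rec :: "int \<times> int \<times> int \<times> int \<Rightarrow> (nat \<Rightarrow> int) \<Rightarrow> bool" where
  "first_kind_rec = (\<lambda>(a, b, c, d) u. u 0 = 1 \<and>
     (\<forall>n. (int n + 1)^3 * u (n + 1) - (2 * int n + 1) * (a * int n ^ 2 + a * int n + b) * u n
            + int n * (c * int n ^ 2 + d) * prev u n = 0))"

(* Triples (A, B, lambda), in the order A, B, C, D, E, F. *)
definition second_kind_params :: "(int \<times> int \<times> int) set" where
  "second_kind_params =
     {(7, -8, 2), (9, 27, 3), (10, 9, 3), (11, -1, 3), (12, 32, 4), (17, 72, 6)}"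

(* Quadruples (a, b, c, d), in the order delta, eta, alpha, epsilon, zeta, gamma, s7, s10, s18. *)
definition first_kind_params :: "(int \<times> int \<times> int \<times> int) set" where
  "first_kind_params =
     {(7, 3, 81, 0), (11, 5, 125, 0), (10, 4, 64, 0), (12, 4, 16, 0), (9, 3, -27, 0),
      (17, 5, 1, 0), (13, 4, -27, 3), (6, 2, -64, 4), (14, 6, 192, -12)}"

datatype apery_kind = First_Kind | Second_Kind

(* The recurrence determines u uniquely over the rationals; that the solution for each listed
   parameter tuple consists of integers is classical. *)
fun apery_like :: "apery_kind \<Rightarrow> (nat \<Rightarrow> int) \<Rightarrow> bool" where
  "apery_like Second_Kind u = (\<exists>p \<in> second_kind_params. second_kind_rec p u)"
| "apery_like First_Kind u = (\<exists>p \<in> first_kind_params. first_kind_rec p u)"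

definition binomial_transform :: "(nat \<Rightarrow> 'a::comm_ring_1) \<Rightarrow> 'a \<Rightarrow> nat \<Rightarrow> 'a" where
  "binomial_transform u x n = (\<Sum>k=0..n. of_nat (n choose k) * (- x) ^ (n - k) * u k)"

fun apery_M :: "apery_kind \<Rightarrow> (nat \<Rightarrow> int) \<Rightarrow> int \<Rightarrow> int" where
  "apery_M Second_Kind u \<alpha> = Gcd (binomial_transform u \<alpha> ` {1..3})"
| "apery_M First_Kind u \<alpha> = Gcd (binomial_transform u \<alpha> ` {1..4})"

(* Meaningful for M > 0 only (for M = 0 the set is infinite). The gcd apery_M never vanishes on
   the 15 sequences: v_1 = 0 forces \<alpha> = u 1, and then v_2 = u 2 - (u 1)^2 or
   v_3 = u 3 - (u 1)^3 is nonzero. *)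
definition squarefree_divisor :: "int \<Rightarrow> int" where
  "squarefree_divisor M = Max {d. d dvd M \<and> squarefree d}"

end

theory Submission
  imports Defs "HOL-Computational_Algebra.Formal_Power_Series"
begin

text \<open>
  Put \<open>l = u 1\<close>. Since \<open>v\<^sub>1(\<alpha>) = l - \<alpha>\<close>, the number \<open>M\<^sub>\<alpha>\<close> divides \<open>l - \<alpha>\<close>, and then it divides
  \<open>v\<^sub>2(l)\<close> and \<open>v\<^sub>3(l)\<close>, two numbers that do not involve \<open>\<alpha>\<close>. For each of the fifteen sequences these
  two numbers have a nonzero gcd, all of whose squarefree divisors divide a small number \<open>N\<close>, namely
  2, 6 or 10. So everything comes down to fifteen congruences \<open>u n \<equiv> l ^ n\<close> modulo \<open>N\<close>, for all \<open>n\<close>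
  (lemma \<open>cong_mod_squarefree_divisor\<close>).

  The recurrence alone says nothing about \<open>u (n + 1)\<close> modulo a prime \<open>p\<close> as soon as \<open>p\<close> divides \<open>n + 1\<close>,
  so the congruences have to come from explicit formulas. A formula of the shape
  \<open>u n = (\<Sum>k. l ^ (n - j * k) * b n k * c k)\<close>, with binomial coefficients \<open>b n k\<close>, with
  \<open>b n 0 = c 0 = 1\<close> and with \<open>N\<close> dividing \<open>c k\<close> for
  all positive \<open>k\<close> gives the congruence at once; it is the coefficient form of a pullback
  \<open>(\<Sum>n. u n * x ^ n) = 1 / (1 - l * x) * (\<Sum>k. c k * R x ^ k)\<close> of a hypergeometric series, where \<open>c k\<close> is
  \<open>(3 * k)! / k! ^ 3\<close> or \<open>(2 * k choose k) ^ 2\<close> or \<open>(4 * k)! / k! ^ 4\<close>. Such formulas exist for A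
  (the Franel numbers), B, E and \<open>\<epsilon>\<close>; similar sums of products of binomial coefficients serve D,
  \<open>s\<^sub>7\<close>, \<open>s\<^sub>1\<^sub>0\<close> and \<open>s\<^sub>1\<^sub>8\<close>. All eight formulas are proved by creative telescoping: both sides
  satisfy the same recurrence, and an explicit certificate reduces this to a polynomial identity.

  The remaining sequences are obtained from these. C and F are binomial transforms of the Franel numbers
  (theorem \<open>binomial_transform_second_kind\<close>). D satisfies Lucas congruences, which reduce the congruence
  modulo 5 to \<open>n < 5\<close> (theorem \<open>zagier_D_Lucas\<close>). Finally \<open>\<delta>\<close>, \<open>\<eta>\<close>, \<open>\<alpha>\<close>, \<open>\<zeta>\<close> and \<open>\<gamma>\<close> are linked to
  A, D, C, B and F by the quadratic transformation
  \<open>D(x) * U(x)\<^sup>2 = T(- x / D(x))\<close> with \<open>D(x) = 1 - A * x + B * x\<^sup>2\<close>, where \<open>U\<close> and \<open>T\<close> are the generating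
  functions of the second and first kind (theorem \<open>quadratic_transformation\<close>). If
  \<open>U \<equiv> 1 / (1 - l * x)\<close> and \<open>B \<equiv> l\<^sup>2\<close> modulo \<open>N\<close>, then the left side is congruent to
  \<open>D / (1 - 2 * l * x + B * x\<^sup>2)\<close>, which is the value of \<open>1 / (1 - (A - 2 * l) * y)\<close> at \<open>y = - x / D\<close>;
  this gives the congruence for \<open>T\<close> (theorem \<open>first_kind_cong_from_second_kind\<close>).
\<close>

section \<open>The recurrences over the integers\<close>

text \<open>
  The instance \<open>n = 0\<close> of the recurrence only fixes \<open>u 1\<close>, as \<open>l\<close> or \<open>b\<close>; the instances from 1 on do not
  refer to the index \<open>-1\<close>.
\<close>

lemma second_kind_rec_iff:
  "second_kind_rec (A, B, l) u \<longleftrightarrow> u 0 = 1 \<and> u 1 = l \<and>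
     (\<forall>n. (int n + 2)^2 * u (n + 2) - (A * (int n + 1)^2 + A * (int n + 1) + l) * u (n + 1)
            + B * (int n + 1)^2 * u n = 0)"
proof -
  have split: "(\<forall>n. P n) \<longleftrightarrow> P 0 \<and> (\<forall>n. P (n + 1))" for P :: "nat \<Rightarrow> bool"
    by (metis Suc_eq_plus1 not0_implies_Suc)
  show ?thesis
    unfolding second_kind_rec_def prev_def prod.case
    by (subst split) (auto simp: algebra_simps)
qed

lemma first_kind_rec_iff:
  "first_kind_rec (a, b, c, d) u \<longleftrightarrow> u 0 = 1 \<and> u 1 = b \<and>
     (\<forall>n. (int n + 2)^3 * u (n + 2)
            - (2 * int n + 3) * (a * (int n + 1)^2 + a * (int n + 1) + b) * u (n + 1)
            + (int n + 1) * (c * (int n + 1)^2 + d) * u n = 0)"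
proof -
  have split: "(\<forall>n. P n) \<longleftrightarrow> P 0 \<and> (\<forall>n. P (n + 1))" for P :: "nat \<Rightarrow> bool"
    by (metis Suc_eq_plus1 not0_implies_Suc)
  show ?thesis
    unfolding first_kind_rec_def prev_def prod.case
    by (subst split) (auto simp: algebra_simps)
qed

lemma three_term_unique:
  fixes u v :: "nat \<Rightarrow> int"
  assumes "u 0 = v 0" "u 1 = v 1"
    and "\<And>n. p n \<noteq> 0"
    and "\<And>n. p n * u (n + 2) - q n * u (n + 1) + r n * u n = 0"
    and "\<And>n. p n * v (n + 2) - q n * v (n + 1) + r n * v n = 0"
  shows "u = v"
proof
  fix n
  show "u n = v n"
  proof (induction n rule: induct_nat_012)
    case (ge2 n)
    have "p n * u (n + 2) = q n * u (n + 1) - r n * u n"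
      using assms(4)[of n] by linarith
    also have "\<dots> = p n * v (n + 2)"
      using assms(5)[of n] ge2 by simp
    finally show ?case using assms(3)[of n] by simp
  qed (use assms in auto)
qed

lemma second_kind_rec_unique:
  assumes "second_kind_rec (A, B, l) u" "second_kind_rec (A, B, l) v"
  shows "u = v"
  by (rule three_term_unique[where p = "\<lambda>n. (int n + 2)^2"
        and q = "\<lambda>n. A * (int n + 1)^2 + A * (int n + 1) + l" and r = "\<lambda>n. B * (int n + 1)^2"])
     (use assms in \<open>auto simp: second_kind_rec_iff\<close>)

lemma first_kind_rec_unique:
  assumes "first_kind_rec (a, b, c, d) u" "first_kind_rec (a, b, c, d) v"
  shows "u = v"
  by (rule three_term_unique[where p = "\<lambda>n. (int n + 2)^3"
        and q = "\<lambda>n. (2 * int n + 3) * (a * (int n + 1)^2 + a * (int n + 1) + b)"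
        and r = "\<lambda>n. (int n + 1) * (c * (int n + 1)^2 + d)"])
     (use assms in \<open>auto simp: first_kind_rec_iff\<close>)

section \<open>Creative telescoping\<close>

text \<open>
  If the recurrence operator in \<open>n\<close>, applied to a summand \<open>F n k\<close>, gives a difference \<open>G (Suc k) - G k\<close>,
  then the sum over \<open>k\<close> is annihilated, provided that \<open>G\<close> vanishes at both ends of the common range
  \<open>{..<n + 3}\<close> of summation for \<open>n\<close>, \<open>n + 1\<close> and \<open>n + 2\<close>.
\<close>

lemma creative_telescoping:
  fixes F :: "nat \<Rightarrow> nat \<Rightarrow> rat" and u :: "nat \<Rightarrow> int" and n :: nat and p q r :: int
  assumes u: "\<And>n. of_int (u n) = (\<Sum>k\<le>n. F n k)"
    and zero: "\<And>n k. n < k \<Longrightarrow> F n k = 0"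
    and cert: "\<And>k. of_int p * F (n + 2) k - of_int q * F (n + 1) k + of_int r * F n k = G (Suc k) - G k"
    and G: "G 0 = 0" "G (n + 3) = 0"
  shows "p * u (n + 2) - q * u (n + 1) + r * u n = 0"
proof -
  have ext: "of_int (u m) = (\<Sum>k<n + 3. F m k)" if "m \<le> n + 2" for m
    unfolding u by (rule sum.mono_neutral_left) (use that zero in auto)
  have "of_int (p * u (n + 2) - q * u (n + 1) + r * u n)
      = (\<Sum>k<n + 3. of_int p * F (n + 2) k - of_int q * F (n + 1) k + of_int r * F n k)"
    by (simp add: ext sum_distrib_left sum.distrib sum_subtractf)
  also have "\<dots> = (\<Sum>k<n + 3. G (Suc k) - G k)"
    by (simp only: cert)
  also have "\<dots> = 0"
    by (simp only: sum_lessThan_telescope G diff_self)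
  finally show ?thesis by (metis of_int_eq_0_iff)
qed

lemma second_kind_rec_telescoping:
  fixes F G :: "nat \<Rightarrow> nat \<Rightarrow> rat"
  assumes "u 0 = 1" "u 1 = l" "\<And>n. of_int (u n) = (\<Sum>k\<le>n. F n k)"
    and "\<And>n k. n < k \<Longrightarrow> F n k = 0"
    and "\<And>n k. of_int ((int n + 2)^2) * F (n + 2) k
        - of_int (A * (int n + 1)^2 + A * (int n + 1) + l) * F (n + 1) k
        + of_int (B * (int n + 1)^2) * F n k = G n (Suc k) - G n k"
    and "\<And>n. G n 0 = 0" "\<And>n. G n (n + 3) = 0"
  shows "second_kind_rec (A, B, l) u"
  unfolding second_kind_rec_iff
proof (intro conjI allI)
  show "(int n + 2)^2 * u (n + 2) - (A * (int n + 1)^2 + A * (int n + 1) + l) * u (n + 1)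
          + B * (int n + 1)^2 * u n = 0" for n
    by (rule creative_telescoping[where F = F and G = "G n"]) (rule assms | assumption)+
qed (use assms in auto)

lemma first_kind_rec_telescoping:
  fixes F G :: "nat \<Rightarrow> nat \<Rightarrow> rat"
  assumes "u 0 = 1" "u 1 = b" "\<And>n. of_int (u n) = (\<Sum>k\<le>n. F n k)"
    and "\<And>n k. n < k \<Longrightarrow> F n k = 0"
    and "\<And>n k. of_int ((int n + 2)^3) * F (n + 2) k
        - of_int ((2 * int n + 3) * (a * (int n + 1)^2 + a * (int n + 1) + b)) * F (n + 1) k
        + of_int ((int n + 1) * (c * (int n + 1)^2 + d)) * F n k = G n (Suc k) - G n k"
    and "\<And>n. G n 0 = 0" "\<And>n. G n (n + 3) = 0"
  shows "first_kind_rec (a, b, c, d) u"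
  unfolding first_kind_rec_iff
proof (intro conjI allI)
  show "(int n + 2)^3 * u (n + 2)
          - (2 * int n + 3) * (a * (int n + 1)^2 + a * (int n + 1) + b) * u (n + 1)
          + (int n + 1) * (c * (int n + 1)^2 + d) * u n = 0" for n
    by (rule creative_telescoping[where F = F and G = "G n"]) (rule assms | assumption)+
qed (use assms in auto)

section \<open>Weighted reciprocal factorials\<close>

text \<open>
  Reciprocal factorials, extended by 0 to the negative integers and weighted by a power. With this
  extension the rule \<open>c * wfact c (m - 1) = m * wfact c m\<close> has no exceptions, so that the summands below and their
  shifts in \<open>n\<close> and \<open>k\<close> are polynomial multiples of one common factor, without any case distinction
  at the boundary of the range of summation.
\<close>

definition wfact :: "rat \<Rightarrow> int \<Rightarrow> rat" where
  "wfact c m = (if m < 0 then 0 else c ^ nat m / fact (nat m))"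

lemma wfact_neg [simp]: "m < 0 \<Longrightarrow> wfact c m = 0"
  by (simp add: wfact_def)

lemma wfact_diff: "m \<le> n \<Longrightarrow> wfact c (int n - int m) = c ^ (n - m) / fact (n - m)"
  by (simp add: wfact_def flip: of_nat_diff)

lemma wfact_step:
  assumes "c \<noteq> 0" "m' = m + 1"
  shows "wfact c m = of_int m' / c * wfact c m'"
proof -
  consider "m < - 1" | "m = - 1" | "m \<ge> 0" by linarith
  then show ?thesis
  proof cases
    case 3
    then obtain j where j: "m = int j" by (metis nonneg_int_cases)
    have "wfact c m' = c ^ Suc j / (of_nat (Suc j) * fact j)"
      using wfact_diff[of 0 "Suc j" c] j assms(2) by (simp add: add.commute)
    moreover have "wfact c m = c ^ j / fact j" "of_int m' = (of_nat (Suc j) :: rat)"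
      using wfact_diff[of 0 j c] j assms(2) by simp_all
    ultimately show ?thesis using assms(1) by (simp del: of_nat_Suc)
  qed (auto simp: wfact_def assms)
qed

text \<open>
  Consecutive values as polynomial multiples of one number \<open>W\<close>; scaling \<open>W\<close> by a power of \<open>c\<close> avoids
  denominators.
\<close>

lemma wfact_descend2:
  assumes "c \<noteq> 0"
  obtains W where "wfact c (m + 2) = c^2 * W" "wfact c (m + 1) = c * (of_int m + 2) * W"
    "wfact c m = (of_int m + 2) * (of_int m + 1) * W"
proof
  show "wfact c (m + 2) = c^2 * (wfact c (m + 2) / c^2)"
    using assms by simp
  show *: "wfact c (m + 1) = c * (of_int m + 2) * (wfact c (m + 2) / c^2)"
    using wfact_step[of c "m + 2" "m + 1"] assms by (simp add: power2_eq_square)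
  show "wfact c m = (of_int m + 2) * (of_int m + 1) * (wfact c (m + 2) / c^2)"
    using wfact_step[of c "m + 1" m] * assms by simp
qed

lemma wfact_descend3:
  assumes "c \<noteq> 0"
  obtains W where "wfact c (m + 3) = c^3 * W" "wfact c (m + 2) = c^2 * (of_int m + 3) * W"
    "wfact c (m + 1) = c * (of_int m + 3) * (of_int m + 2) * W"
    "wfact c m = (of_int m + 3) * (of_int m + 2) * (of_int m + 1) * W"
proof -
  obtain W where W: "wfact c (m + 2) = c^2 * W" "wfact c (m + 1) = c * (of_int m + 2) * W"
    "wfact c m = (of_int m + 2) * (of_int m + 1) * W"
    by (rule wfact_descend2[OF assms])
  have "W * c^3 = (of_int m + 3) * wfact c (m + 3)"
    using wfact_step[of c "m + 3" "m + 2"] W(1) assms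
    by (simp add: field_simps power2_eq_square power3_eq_cube)
  then have "W = (of_int m + 3) * (wfact c (m + 3) / c^3)"
    using assms by (simp add: field_simps)
  then show ?thesis
    using that[of "wfact c (m + 3) / c^3"] W assms by (simp add: mult_ac)
qed

lemma power_div_fact_Suc:
  "of_nat (Suc k) ^ j / fact (Suc k) ^ j = (1 / fact k ^ j :: rat)"
  by (simp add: power_mult_distrib del: of_nat_Suc)

lemma fact_double_Suc_div:
  "fact (2 * Suc k) / fact (Suc k) = (2 * (2 * of_nat k + 1) * (fact (2 * k) / fact k) :: rat)"
proof -
  have "2 * Suc k = Suc (Suc (2 * k))" by simp
  then have "fact (2 * Suc k) = (2 * of_nat (Suc k) * (2 * of_nat k + 1) * fact (2 * k) :: rat)"
    by (simp only: fact_Suc) (simp add: algebra_simps)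
  then show ?thesis by (simp only: fact_Suc[of k]) (simp del: of_nat_Suc fact_Suc)
qed

section \<open>Divisibility of binomial coefficients\<close>

lemma dvd_choose_mult_self:
  assumes "0 < k"
  shows "m dvd (m * k choose k)"
proof -
  have "k * (m * k choose k) = k * (m * ((m * k - 1) choose (k - 1)))"
    using times_binomial_minus1_eq[OF assms, of "m * k"] by (simp add: mult_ac)
  then have "(m * k choose k) = m * ((m * k - 1) choose (k - 1))"
    using assms by simp
  then show ?thesis by simp
qed

lemma two_dvd_central: "0 < k \<Longrightarrow> 2 dvd int (2 * k choose k)"
  using dvd_choose_mult_self[of k 2] by presburger

lemma three_dvd_choose: "0 < k \<Longrightarrow> 3 dvd int (3 * k choose k)"
  using dvd_choose_mult_self[of k 3] by presburger

lemma six_dvd_multinomial: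
  assumes "0 < k"
  shows "6 dvd int (3 * k choose k) * int (2 * k choose k)"
  using mult_dvd_mono[OF three_dvd_choose[OF assms] two_dvd_central[OF assms]] by simp

lemma cong_sum_head:
  fixes f :: "nat \<Rightarrow> int"
  assumes "\<And>k. 0 < k \<Longrightarrow> k \<le> n \<Longrightarrow> m dvd f k"
  shows "[(\<Sum>k\<le>n. f k) = f 0] (mod m)"
proof -
  have "(\<Sum>k\<le>n. f k) - f 0 = (\<Sum>k\<in>{..n} - {0}. f k)"
    by (simp add: sum_diff1)
  also have "m dvd \<dots>"
    using assms by (intro dvd_sum) auto
  finally show ?thesis by (simp add: cong_iff_dvd_diff)
qed

lemma choose_times_choose_add:
  "k \<le> n \<Longrightarrow> (n choose k) * (n + k choose k) = (n + k choose (2 * k)) * (2 * k choose k)"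
  using choose_mult[of k "2 * k" "n + k"] by (simp add: mult_2 mult.commute)

lemma even_choose_times_choose_add:
  assumes "0 < k" "k \<le> n"
  shows "2 dvd int (n choose k) * int (n + k choose k)"
proof -
  have "int (n choose k) * int (n + k choose k) = int (n + k choose (2 * k)) * int (2 * k choose k)"
    using choose_times_choose_add[OF assms(2)] by (metis of_nat_mult)
  then show ?thesis using two_dvd_central[OF assms(1)] by simp
qed

section \<open>Eight closed forms\<close>

text \<open>
  In this section \<open>*_term\<close> is the summand of a closed form, written with factorials, and \<open>*_cert\<close> the
  certificate: a polynomial multiple of the summand, found by Zeilberger's method, whose difference in \<open>k\<close> is the
  recurrence applied to the summand. In each of the proofs, \<open>w\<close> is a common factor of all
  five quantities; after division by it a polynomial identity in \<open>N = n\<close> and \<open>K = k\<close> is left. The variable \<open>M\<close>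
  names the smallest argument at which a reciprocal factorial occurs. The certificates contain a power of \<open>k\<close>
  that makes them vanish at \<open>k = 0\<close> and cancels against \<open>fact (Suc k)\<close> in the shifted certificate.
\<close>

text \<open>
  The Franel numbers \<open>(\<Sum>k\<le>n. (n choose k) ^ 3)\<close> in MacMahon's form, from which the residues modulo 6 can
  be read off: the factor \<open>(3 * k choose k) * (2 * k choose k)\<close> is \<open>(3 * k)! / k! ^ 3\<close>. When \<open>2 * k > n\<close> the
  truncated exponent does no harm, because the first binomial coefficient vanishes.
\<close>

definition franel :: "nat \<Rightarrow> int" where
  "franel n = (\<Sum>k\<le>n. int (n + k choose (3 * k)) * int (3 * k choose k) * int (2 * k choose k)
      * 2 ^ (n - 2 * k))"

definition franel_term :: "nat \<Rightarrow> nat \<Rightarrow> rat" where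
  "franel_term n k = fact (n + k) * (1 / fact k ^ 3) * wfact 2 (int n - 2 * int k)"

definition franel_cert :: "nat \<Rightarrow> nat \<Rightarrow> rat" where
  "franel_cert n k = - (18 * of_nat n + 24) * (of_nat k ^ 3 / fact k ^ 3) * fact (n + k)
      * wfact 2 (int n + 2 - 2 * int k)"

lemma franel_telescoping:
  "of_int ((int n + 2)^2) * franel_term (n + 2) k
        - of_int (7 * (int n + 1)^2 + 7 * (int n + 1) + 2) * franel_term (n + 1) k
        + of_int ((-8) * (int n + 1)^2) * franel_term n k
      = franel_cert n (Suc k) - franel_cert n k"
proof -
  define N K :: rat where "N = of_nat n" and "K = of_nat k"
  define M where "M = int n - 2 * int k"
  have M_of: "of_int M = N - 2 * K"
    by (simp add: M_def N_def K_def)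
  have e: "int (n + 2) - 2 * int k = M + 2"
    "int n + 2 - 2 * int k = M + 2"
    "int (n + 1) - 2 * int k = M + 1"
    "int n - 2 * int k = M"
    "int n + 2 - 2 * int (Suc k) = M"
    "n + 2 + k = Suc (Suc (n + k))"
    "n + 1 + k = Suc (n + k)"
    "n + Suc k = Suc (n + k)"
    by (simp_all add: M_def)
  obtain W where W: "wfact 2 (M + 2) = 2^2 * W" "wfact 2 (M + 1) = 2 * (of_int M + 2) * W"
      "wfact 2 M = (of_int M + 2) * (of_int M + 1) * W"
    by (rule wfact_descend2[of 2 M]) auto
  define R where "R = (1 / fact k ^ 3 :: rat)"
  have KR: "of_nat k ^ 3 / fact k ^ 3 = K ^ 3 * R"
    by (simp add: R_def K_def)
  define w where "w = fact (n + k) * R * W"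
  note reduce = KR e W M_of R_def[symmetric] fact_Suc w_def N_def K_def
  have F2: "franel_term (n + 2) k = 4 * (N + K + 2) * (N + K + 1) * w"
    unfolding franel_term_def unfolding reduce
    by (simp only: of_nat_simps of_nat_numeral of_nat_1)? Groebner_Basis.algebra
  have F1: "franel_term (n + 1) k = 2 * (N + K + 1) * (N + 2 - 2 * K) * w"
    unfolding franel_term_def unfolding reduce
    by (simp only: of_nat_simps of_nat_numeral of_nat_1)? Groebner_Basis.algebra
  have F0: "franel_term n k = (N + 2 - 2 * K) * (N + 1 - 2 * K) * w"
    unfolding franel_term_def unfolding reduce
    by (simp only: of_nat_simps of_nat_numeral of_nat_1)? Groebner_Basis.algebra
  have G0: "franel_cert n k = - 4 * (18 * N + 24) * K ^ 3 * w"
    unfolding franel_cert_def unfolding reduce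
    by (simp only: of_nat_simps of_nat_numeral of_nat_1)? Groebner_Basis.algebra
  have G1: "franel_cert n (Suc k) = - (18 * N + 24) * (N + K + 1) * (N + 2 - 2 * K) * (N + 1 - 2 * K) * w"
    unfolding franel_cert_def power_div_fact_Suc unfolding reduce
    by (simp only: of_nat_simps of_nat_numeral of_nat_1)? Groebner_Basis.algebra
  show ?thesis
    unfolding F2 F1 F0 G0 G1 by (simp add: N_def K_def) Groebner_Basis.algebra
qed

lemma franel_term_int:
  "of_int (int (n + k choose (3 * k)) * int (3 * k choose k) * int (2 * k choose k) * 2 ^ (n - 2 * k))
      = franel_term n k"
proof (cases "2 * k \<le> n")
  case True
  then have "n + k - 3 * k = n - 2 * k" "3 * k - k = 2 * k" "2 * k - k = k" by auto
  then show ?thesis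
    using True wfact_diff[OF True, of 2]
    by (simp add: franel_term_def binomial_fact power3_eq_cube)
next
  case False
  then have "wfact 2 (int n - 2 * int k) = 0" by simp
  with False show ?thesis by (simp add: franel_term_def binomial_eq_0)
qed

lemma franel_rec: "second_kind_rec (7, -8, 2) franel"
proof (rule second_kind_rec_telescoping[where F = franel_term and G = franel_cert,
    OF _ _ _ _ franel_telescoping])
  show "of_int (franel n) = sum (franel_term n) {..n}" for n
    unfolding franel_def of_int_sum franel_term_int ..
qed (auto simp: franel_def franel_term_def franel_cert_def eval_nat_numeral)

lemma franel_cong: "[franel n = 2 ^ n] (mod 6)"
proof -
  have "6 dvd int (n + k choose (3 * k)) * int (3 * k choose k) * int (2 * k choose k) * 2 ^ (n - 2 * k)"
      if "0 < k" for k
    using dvd_mult2[OF dvd_mult[OF six_dvd_multinomial[OF that], of "int (n + k choose (3 * k))"],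
        of "2 ^ (n - 2 * k)"]
    by (simp only: mult.assoc)
  from cong_sum_head[OF this, of n "\<lambda>k. k"] show ?thesis
    by (simp add: franel_def)
qed

definition zagier_B :: "nat \<Rightarrow> int" where
  "zagier_B n = (\<Sum>k\<le>n. (- 1) ^ k * int (n choose (3 * k)) * int (3 * k choose k) * int (2 * k choose k)
      * 3 ^ (n - 3 * k))"

definition zagier_B_term :: "nat \<Rightarrow> nat \<Rightarrow> rat" where
  "zagier_B_term n k = (- 1) ^ k * fact n * (1 / fact k ^ 3) * wfact 3 (int n - 3 * int k)"

definition zagier_B_cert :: "nat \<Rightarrow> nat \<Rightarrow> rat" where
  "zagier_B_cert n k = - (27 * of_nat n + 27) * (of_nat k ^ 3 / fact k ^ 3) * (- 1) ^ k * fact n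
      * wfact 3 (int n + 2 - 3 * int k)"

lemma zagier_B_telescoping:
  "of_int ((int n + 2)^2) * zagier_B_term (n + 2) k
        - of_int (9 * (int n + 1)^2 + 9 * (int n + 1) + 3) * zagier_B_term (n + 1) k
        + of_int (27 * (int n + 1)^2) * zagier_B_term n k
      = zagier_B_cert n (Suc k) - zagier_B_cert n k"
proof -
  define N K :: rat where "N = of_nat n" and "K = of_nat k"
  define M where "M = int n - 1 - 3 * int k"
  have M_of: "of_int M = N - 1 - 3 * K"
    by (simp add: M_def N_def K_def)
  have e: "int (n + 2) - 3 * int k = M + 3"
    "int n + 2 - 3 * int k = M + 3"
    "int (n + 1) - 3 * int k = M + 2"
    "int n - 3 * int k = M + 1"
    "int n + 2 - 3 * int (Suc k) = M"
    "fact (n + 2) = fact (Suc (Suc n))"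
    "fact (n + 1) = fact (Suc n)"
    "(- 1 :: rat) ^ Suc k = - ((- 1) ^ k)"
    by (simp_all add: M_def)
  obtain W where W: "wfact 3 (M + 3) = 3^3 * W" "wfact 3 (M + 2) = 3^2 * (of_int M + 3) * W"
      "wfact 3 (M + 1) = 3 * (of_int M + 3) * (of_int M + 2) * W"
      "wfact 3 M = (of_int M + 3) * (of_int M + 2) * (of_int M + 1) * W"
    by (rule wfact_descend3[of 3 M]) auto
  define R where "R = (1 / fact k ^ 3 :: rat)"
  have KR: "of_nat k ^ 3 / fact k ^ 3 = K ^ 3 * R"
    by (simp add: R_def K_def)
  define w where "w = (- 1) ^ k * fact n * R * W"
  note reduce = KR e W M_of R_def[symmetric] fact_Suc w_def N_def K_def
  have F2: "zagier_B_term (n + 2) k = 27 * (N + 2) * (N + 1) * w"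
    unfolding zagier_B_term_def unfolding reduce
    by (simp only: of_nat_simps of_nat_numeral of_nat_1)? Groebner_Basis.algebra
  have F1: "zagier_B_term (n + 1) k = 9 * (N + 1) * (N + 2 - 3 * K) * w"
    unfolding zagier_B_term_def unfolding reduce
    by (simp only: of_nat_simps of_nat_numeral of_nat_1)? Groebner_Basis.algebra
  have F0: "zagier_B_term n k = 3 * (N + 2 - 3 * K) * (N + 1 - 3 * K) * w"
    unfolding zagier_B_term_def unfolding reduce
    by (simp only: of_nat_simps of_nat_numeral of_nat_1)? Groebner_Basis.algebra
  have G0: "zagier_B_cert n k = - 27 * (27 * N + 27) * K ^ 3 * w"
    unfolding zagier_B_cert_def unfolding reduce
    by (simp only: of_nat_simps of_nat_numeral of_nat_1)? Groebner_Basis.algebra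
  have G1: "zagier_B_cert n (Suc k) = (27 * N + 27) * (N + 2 - 3 * K) * (N + 1 - 3 * K) * (N - 3 * K) * w"
    unfolding zagier_B_cert_def power_div_fact_Suc unfolding reduce
    by (simp only: of_nat_simps of_nat_numeral of_nat_1)? Groebner_Basis.algebra
  show ?thesis
    unfolding F2 F1 F0 G0 G1 by (simp add: N_def K_def) Groebner_Basis.algebra
qed

lemma zagier_B_term_int:
  "of_int ((- 1) ^ k * int (n choose (3 * k)) * int (3 * k choose k) * int (2 * k choose k)
      * 3 ^ (n - 3 * k)) = zagier_B_term n k"
proof (cases "3 * k \<le> n")
  case True
  have "3 * k - k = 2 * k" "2 * k - k = k" by auto
  then show ?thesis
    using True wfact_diff[OF True, of 3]
    by (simp add: zagier_B_term_def binomial_fact power3_eq_cube)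
next
  case False
  then have "wfact 3 (int n - 3 * int k) = 0" by simp
  with False show ?thesis by (simp add: zagier_B_term_def binomial_eq_0)
qed

lemma zagier_B_rec: "second_kind_rec (9, 27, 3) zagier_B"
proof (rule second_kind_rec_telescoping[where F = zagier_B_term and G = zagier_B_cert,
    OF _ _ _ _ zagier_B_telescoping])
  show "of_int (zagier_B n) = sum (zagier_B_term n) {..n}" for n
    unfolding zagier_B_def of_int_sum zagier_B_term_int ..
qed (auto simp: zagier_B_def zagier_B_term_def zagier_B_cert_def eval_nat_numeral)

lemma zagier_B_cong: "[zagier_B n = 3 ^ n] (mod 6)"
proof -
  have "6 dvd (- 1) ^ k * int (n choose (3 * k)) * int (3 * k choose k) * int (2 * k choose k)
      * 3 ^ (n - 3 * k)" if "0 < k" for k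
    using dvd_mult2[OF dvd_mult[OF six_dvd_multinomial[OF that], of "(- 1) ^ k * int (n choose (3 * k))"],
        of "3 ^ (n - 3 * k)"]
    by (simp only: mult.assoc)
  from cong_sum_head[OF this, of n "\<lambda>k. k"] show ?thesis
    by (simp add: zagier_B_def)
qed

definition zagier_D :: "nat \<Rightarrow> int" where
  "zagier_D n = (\<Sum>k\<le>n. int (n choose k) ^ 2 * int (n + k choose k))"

definition zagier_D_term :: "nat \<Rightarrow> nat \<Rightarrow> rat" where
  "zagier_D_term n k = fact (n + k) * fact n * (1 / fact k ^ 3) * wfact 1 (int n - int k) ^ 2"

definition zagier_D_cert :: "nat \<Rightarrow> nat \<Rightarrow> rat" where
  "zagier_D_cert n k = (of_nat n + 1) * (of_nat k ^ 2 + (6 * of_nat n + 7) * of_nat k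
      - (11 * of_nat n ^ 2 + 37 * of_nat n + 30)) * (of_nat k ^ 3 / fact k ^ 3) * fact (n + k) * fact n
      * wfact 1 (int n + 2 - int k) ^ 2"

lemma zagier_D_telescoping:
  "of_int ((int n + 2)^2) * zagier_D_term (n + 2) k
        - of_int (11 * (int n + 1)^2 + 11 * (int n + 1) + 3) * zagier_D_term (n + 1) k
        + of_int ((-1) * (int n + 1)^2) * zagier_D_term n k
      = zagier_D_cert n (Suc k) - zagier_D_cert n k"
proof -
  define N K :: rat where "N = of_nat n" and "K = of_nat k"
  define M where "M = int n - int k"
  have M_of: "of_int M = N - K"
    by (simp add: M_def N_def K_def)
  have e: "int (n + 2) - int k = M + 2"
    "int n + 2 - int k = M + 2"
    "int (n + 1) - int k = M + 1"
    "int n - int k = M"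
    "int n + 2 - int (Suc k) = M + 1"
    "fact (n + 2) = fact (Suc (Suc n))"
    "fact (n + 1) = fact (Suc n)"
    "n + 2 + k = Suc (Suc (n + k))"
    "n + 1 + k = Suc (n + k)"
    "n + Suc k = Suc (n + k)"
    by (simp_all add: M_def)
  obtain W where W: "wfact 1 (M + 2) = W" "wfact 1 (M + 1) = (of_int M + 2) * W"
      "wfact 1 M = (of_int M + 2) * (of_int M + 1) * W"
    by (rule wfact_descend2[of 1 M]) auto
  define R where "R = (1 / fact k ^ 3 :: rat)"
  have KR: "of_nat k ^ 3 / fact k ^ 3 = K ^ 3 * R"
    by (simp add: R_def K_def)
  define w where "w = fact (n + k) * fact n * R * W ^ 2"
  note reduce = KR e W M_of R_def[symmetric] fact_Suc w_def N_def K_def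
  have F2: "zagier_D_term (n + 2) k = (N + K + 2) * (N + K + 1) * (N + 2) * (N + 1) * w"
    unfolding zagier_D_term_def unfolding reduce
    by (simp only: of_nat_simps of_nat_numeral of_nat_1)? Groebner_Basis.algebra
  have F1: "zagier_D_term (n + 1) k = (N + K + 1) * (N + 1) * (N + 2 - K) ^ 2 * w"
    unfolding zagier_D_term_def unfolding reduce
    by (simp only: of_nat_simps of_nat_numeral of_nat_1)? Groebner_Basis.algebra
  have F0: "zagier_D_term n k = ((N + 2 - K) * (N + 1 - K)) ^ 2 * w"
    unfolding zagier_D_term_def unfolding reduce
    by (simp only: of_nat_simps of_nat_numeral of_nat_1)? Groebner_Basis.algebra
  have G0: "zagier_D_cert n k = (N + 1) * (K ^ 2 + (6 * N + 7) * K - (11 * N ^ 2 + 37 * N + 30)) * K ^ 3 * w"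
    unfolding zagier_D_cert_def unfolding reduce
    by (simp only: of_nat_simps of_nat_numeral of_nat_1)? Groebner_Basis.algebra
  have G1: "zagier_D_cert n (Suc k) = (N + 1) * ((K + 1) ^ 2 + (6 * N + 7) * (K + 1)
      - (11 * N ^ 2 + 37 * N + 30)) * (N + K + 1) * (N + 2 - K) ^ 2 * w"
    unfolding zagier_D_cert_def power_div_fact_Suc unfolding reduce
    by (simp only: of_nat_simps of_nat_numeral of_nat_1)? Groebner_Basis.algebra
  show ?thesis
    unfolding F2 F1 F0 G0 G1 by (simp add: N_def K_def) Groebner_Basis.algebra
qed

lemma zagier_D_term_int:
  "of_int (int (n choose k) ^ 2 * int (n + k choose k)) = zagier_D_term n k"
proof (cases "k \<le> n")
  case True
  then show ?thesis
    using wfact_diff[OF True, of 1]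
    by (simp add: zagier_D_term_def binomial_fact field_simps power2_eq_square power3_eq_cube)
qed (simp add: zagier_D_term_def binomial_eq_0)

lemma zagier_D_rec: "second_kind_rec (11, -1, 3) zagier_D"
proof (rule second_kind_rec_telescoping[where F = zagier_D_term and G = zagier_D_cert,
    OF _ _ _ _ zagier_D_telescoping])
  show "of_int (zagier_D n) = sum (zagier_D_term n) {..n}" for n
    unfolding zagier_D_def of_int_sum zagier_D_term_int ..
qed (auto simp: zagier_D_def zagier_D_term_def zagier_D_cert_def)

definition zagier_E :: "nat \<Rightarrow> int" where
  "zagier_E n = (\<Sum>k\<le>n. int (n choose (2 * k)) * int (2 * k choose k) ^ 2 * 4 ^ (n - 2 * k))"

definition zagier_E_term :: "nat \<Rightarrow> nat \<Rightarrow> rat" where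
  "zagier_E_term n k = fact n * (fact (2 * k) / fact k) * (1 / fact k ^ 3) * wfact 4 (int n - 2 * int k)"

definition zagier_E_cert :: "nat \<Rightarrow> nat \<Rightarrow> rat" where
  "zagier_E_cert n k = - (8 * of_nat n + 8) * (of_nat k ^ 3 / fact k ^ 3) * (fact (2 * k) / fact k) * fact n
      * wfact 4 (int n + 2 - 2 * int k)"

lemma zagier_E_telescoping:
  "of_int ((int n + 2)^2) * zagier_E_term (n + 2) k
        - of_int (12 * (int n + 1)^2 + 12 * (int n + 1) + 4) * zagier_E_term (n + 1) k
        + of_int (32 * (int n + 1)^2) * zagier_E_term n k
      = zagier_E_cert n (Suc k) - zagier_E_cert n k"
proof -
  define N K :: rat where "N = of_nat n" and "K = of_nat k"
  define M where "M = int n - 2 * int k"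
  have M_of: "of_int M = N - 2 * K"
    by (simp add: M_def N_def K_def)
  have e: "int (n + 2) - 2 * int k = M + 2"
    "int n + 2 - 2 * int k = M + 2"
    "int (n + 1) - 2 * int k = M + 1"
    "int n - 2 * int k = M"
    "int n + 2 - 2 * int (Suc k) = M"
    "fact (n + 2) = fact (Suc (Suc n))"
    "fact (n + 1) = fact (Suc n)"
    by (simp_all add: M_def)
  obtain W where W: "wfact 4 (M + 2) = 4^2 * W" "wfact 4 (M + 1) = 4 * (of_int M + 2) * W"
      "wfact 4 M = (of_int M + 2) * (of_int M + 1) * W"
    by (rule wfact_descend2[of 4 M]) auto
  define R where "R = (1 / fact k ^ 3 :: rat)"
  define C where "C = (fact (2 * k) / fact k :: rat)"
  have KR: "of_nat k ^ 3 / fact k ^ 3 = K ^ 3 * R"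
    by (simp add: R_def K_def)
  define w where "w = fact n * C * R * W"
  note reduce = KR e W M_of R_def[symmetric] C_def[symmetric] fact_Suc w_def N_def K_def
  have F2: "zagier_E_term (n + 2) k = 16 * (N + 2) * (N + 1) * w"
    unfolding zagier_E_term_def fact_double_Suc_div unfolding reduce
    by (simp only: of_nat_simps of_nat_numeral of_nat_1)? Groebner_Basis.algebra
  have F1: "zagier_E_term (n + 1) k = 4 * (N + 1) * (N + 2 - 2 * K) * w"
    unfolding zagier_E_term_def fact_double_Suc_div unfolding reduce
    by (simp only: of_nat_simps of_nat_numeral of_nat_1)? Groebner_Basis.algebra
  have F0: "zagier_E_term n k = (N + 2 - 2 * K) * (N + 1 - 2 * K) * w"
    unfolding zagier_E_term_def fact_double_Suc_div unfolding reduce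
    by (simp only: of_nat_simps of_nat_numeral of_nat_1)? Groebner_Basis.algebra
  have G0: "zagier_E_cert n k = - 16 * (8 * N + 8) * K ^ 3 * w"
    unfolding zagier_E_cert_def fact_double_Suc_div unfolding reduce
    by (simp only: of_nat_simps of_nat_numeral of_nat_1)? Groebner_Basis.algebra
  have G1: "zagier_E_cert n (Suc k) = - (8 * N + 8) * 2 * (2 * K + 1) * (N + 2 - 2 * K) * (N + 1 - 2 * K) * w"
    unfolding zagier_E_cert_def power_div_fact_Suc fact_double_Suc_div unfolding reduce
    by (simp only: of_nat_simps of_nat_numeral of_nat_1)? Groebner_Basis.algebra
  show ?thesis
    unfolding F2 F1 F0 G0 G1 by (simp add: N_def K_def) Groebner_Basis.algebra
qed

lemma zagier_E_term_int:
  "of_int (int (n choose (2 * k)) * int (2 * k choose k) ^ 2 * 4 ^ (n - 2 * k)) = zagier_E_term n k"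
proof (cases "2 * k \<le> n")
  case True
  have "2 * k - k = k" by auto
  then show ?thesis
    using True wfact_diff[OF True, of 4]
    by (simp add: zagier_E_term_def binomial_fact power2_eq_square power3_eq_cube)
next
  case False
  then have "wfact 4 (int n - 2 * int k) = 0" by simp
  with False show ?thesis by (simp add: zagier_E_term_def binomial_eq_0)
qed

lemma zagier_E_rec: "second_kind_rec (12, 32, 4) zagier_E"
proof (rule second_kind_rec_telescoping[where F = zagier_E_term and G = zagier_E_cert,
    OF _ _ _ _ zagier_E_telescoping])
  show "of_int (zagier_E n) = sum (zagier_E_term n) {..n}" for n
    unfolding zagier_E_def of_int_sum zagier_E_term_int ..
qed (auto simp: zagier_E_def zagier_E_term_def zagier_E_cert_def eval_nat_numeral)

lemma zagier_E_cong: "[zagier_E n = 4 ^ n] (mod 2)"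
proof -
  have "2 dvd int (n choose (2 * k)) * int (2 * k choose k) ^ 2 * 4 ^ (n - 2 * k)" if "0 < k" for k
    using two_dvd_central[OF that] by (simp add: dvd_mult dvd_mult2)
  from cong_sum_head[OF this, of n "\<lambda>k. k"] show ?thesis
    by (simp add: zagier_E_def)
qed

text \<open>
  The coefficient form of \<open>1 / (1 - 4 * x) * (\<Sum>k. (4 * k)! / k! ^ 4 * (x\<^sup>2 / (1 - 4 * x) ^ 4) ^ k)\<close>.
\<close>

definition apery_epsilon :: "nat \<Rightarrow> int" where
  "apery_epsilon n = (\<Sum>k\<le>n. int (n + 2 * k choose (4 * k)) * int (4 * k choose k) * int (3 * k choose k)
      * int (2 * k choose k) * 4 ^ (n - 2 * k))"

definition apery_epsilon_term :: "nat \<Rightarrow> nat \<Rightarrow> rat" where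
  "apery_epsilon_term n k = fact (n + 2 * k) * (1 / fact k ^ 4) * wfact 4 (int n - 2 * int k)"

definition apery_epsilon_cert :: "nat \<Rightarrow> nat \<Rightarrow> rat" where
  "apery_epsilon_cert n k = - (64 * of_nat n + 96) * (of_nat k ^ 4 / fact k ^ 4) * fact (n + 2 * k)
      * wfact 4 (int n + 2 - 2 * int k)"

lemma apery_epsilon_telescoping:
  "of_int ((int n + 2)^3) * apery_epsilon_term (n + 2) k
        - of_int ((2 * int n + 3) * (12 * (int n + 1)^2 + 12 * (int n + 1) + 4)) * apery_epsilon_term (n + 1) k
        + of_int ((int n + 1) * (16 * (int n + 1)^2 + 0)) * apery_epsilon_term n k
      = apery_epsilon_cert n (Suc k) - apery_epsilon_cert n k"
proof -
  define N K :: rat where "N = of_nat n" and "K = of_nat k"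
  define M where "M = int n - 2 * int k"
  have M_of: "of_int M = N - 2 * K"
    by (simp add: M_def N_def K_def)
  have e: "int (n + 2) - 2 * int k = M + 2"
    "int n + 2 - 2 * int k = M + 2"
    "int (n + 1) - 2 * int k = M + 1"
    "int n - 2 * int k = M"
    "int n + 2 - 2 * int (Suc k) = M"
    "n + 2 + 2 * k = Suc (Suc (n + 2 * k))"
    "n + 1 + 2 * k = Suc (n + 2 * k)"
    "n + 2 * Suc k = Suc (Suc (n + 2 * k))"
    by (simp_all add: M_def)
  obtain W where W: "wfact 4 (M + 2) = 4^2 * W" "wfact 4 (M + 1) = 4 * (of_int M + 2) * W"
      "wfact 4 M = (of_int M + 2) * (of_int M + 1) * W"
    by (rule wfact_descend2[of 4 M]) auto
  define R where "R = (1 / fact k ^ 4 :: rat)"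
  have KR: "of_nat k ^ 4 / fact k ^ 4 = K ^ 4 * R"
    by (simp add: R_def K_def)
  define w where "w = fact (n + 2 * k) * R * W"
  note reduce = KR e W M_of R_def[symmetric] fact_Suc w_def N_def K_def
  have F2: "apery_epsilon_term (n + 2) k = 16 * (N + 2 * K + 2) * (N + 2 * K + 1) * w"
    unfolding apery_epsilon_term_def unfolding reduce
    by (simp only: of_nat_simps of_nat_numeral of_nat_1)? Groebner_Basis.algebra
  have F1: "apery_epsilon_term (n + 1) k = 4 * (N + 2 * K + 1) * (N + 2 - 2 * K) * w"
    unfolding apery_epsilon_term_def unfolding reduce
    by (simp only: of_nat_simps of_nat_numeral of_nat_1)? Groebner_Basis.algebra
  have F0: "apery_epsilon_term n k = (N + 2 - 2 * K) * (N + 1 - 2 * K) * w"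
    unfolding apery_epsilon_term_def unfolding reduce
    by (simp only: of_nat_simps of_nat_numeral of_nat_1)? Groebner_Basis.algebra
  have G0: "apery_epsilon_cert n k = - 16 * (64 * N + 96) * K ^ 4 * w"
    unfolding apery_epsilon_cert_def unfolding reduce
    by (simp only: of_nat_simps of_nat_numeral of_nat_1)? Groebner_Basis.algebra
  have G1: "apery_epsilon_cert n (Suc k) = - (64 * N + 96) * (N + 2 * K + 2) * (N + 2 * K + 1)
      * (N + 2 - 2 * K) * (N + 1 - 2 * K) * w"
    unfolding apery_epsilon_cert_def power_div_fact_Suc unfolding reduce
    by (simp only: of_nat_simps of_nat_numeral of_nat_1)? Groebner_Basis.algebra
  show ?thesis
    unfolding F2 F1 F0 G0 G1 by (simp add: N_def K_def) Groebner_Basis.algebra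
qed

lemma apery_epsilon_term_int:
  "of_int (int (n + 2 * k choose (4 * k)) * int (4 * k choose k) * int (3 * k choose k)
      * int (2 * k choose k) * 4 ^ (n - 2 * k)) = apery_epsilon_term n k"
proof (cases "2 * k \<le> n")
  case True
  then have "n + 2 * k - 4 * k = n - 2 * k" "4 * k - k = 3 * k" "3 * k - k = 2 * k" "2 * k - k = k" by auto
  then show ?thesis
    using True wfact_diff[OF True, of 4]
    by (simp add: apery_epsilon_term_def binomial_fact power4_eq_xxxx)
next
  case False
  then have "wfact 4 (int n - 2 * int k) = 0" by simp
  with False show ?thesis by (simp add: apery_epsilon_term_def binomial_eq_0)
qed

lemma apery_epsilon_rec: "first_kind_rec (12, 4, 16, 0) apery_epsilon"
proof (rule first_kind_rec_telescoping[where F = apery_epsilon_term and G = apery_epsilon_cert,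
    OF _ _ _ _ apery_epsilon_telescoping])
  show "of_int (apery_epsilon n) = sum (apery_epsilon_term n) {..n}" for n
    unfolding apery_epsilon_def of_int_sum apery_epsilon_term_int ..
qed (auto simp: apery_epsilon_def apery_epsilon_term_def apery_epsilon_cert_def eval_nat_numeral)

lemma apery_epsilon_cong: "[apery_epsilon n = 4 ^ n] (mod 6)"
proof -
  have "6 dvd int (n + 2 * k choose (4 * k)) * int (4 * k choose k) * int (3 * k choose k)
      * int (2 * k choose k) * 4 ^ (n - 2 * k)" if "0 < k" for k
    using dvd_mult2[OF dvd_mult[OF six_dvd_multinomial[OF that],
        of "int (n + 2 * k choose (4 * k)) * int (4 * k choose k)"], of "4 ^ (n - 2 * k)"]
    by (simp only: mult.assoc)
  from cong_sum_head[OF this, of n "\<lambda>k. k"] show ?thesis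
    by (simp add: apery_epsilon_def)
qed

definition apery_s7 :: "nat \<Rightarrow> int" where
  "apery_s7 n = (\<Sum>k\<le>n. int (n choose k) ^ 2 * int (n + k choose k) * int (2 * k choose n))"

definition apery_s7_term :: "nat \<Rightarrow> nat \<Rightarrow> rat" where
  "apery_s7_term n k = fact (n + k) * (fact (2 * k) / fact k) * (1 / fact k ^ 2)
      * wfact 1 (int n - int k) ^ 2 * wfact 1 (2 * int k - int n)"

definition apery_s7_cert :: "nat \<Rightarrow> nat \<Rightarrow> rat" where
  "apery_s7_cert n k = ((22 + 15 * of_nat n) * of_nat k^2 - (78 + 91 * of_nat n + 26 * of_nat n^2)
      * of_nat k + (44 + 72 * of_nat n + 39 * of_nat n^2 + 7 * of_nat n^3))
    * (of_nat k ^ 2 / fact k ^ 2) * (fact (2 * k) / fact k) * fact (n + k) * wfact 1 (int n + 2 - int k) ^ 2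
    * wfact 1 (2 * int k - (int n + 2))"

lemma apery_s7_telescoping:
  "of_int ((int n + 2)^3) * apery_s7_term (n + 2) k
        - of_int ((2 * int n + 3) * (13 * (int n + 1)^2 + 13 * (int n + 1) + 4)) * apery_s7_term (n + 1) k
        + of_int ((int n + 1) * ((-27) * (int n + 1)^2 + 3)) * apery_s7_term n k
      = apery_s7_cert n (Suc k) - apery_s7_cert n k"
proof -
  define N K :: rat where "N = of_nat n" and "K = of_nat k"
  define M where "M = int n - int k"
  have M_of: "of_int M = N - K"
    by (simp add: M_def N_def K_def)
  have e: "int (n + 2) - int k = M + 2"
    "int n + 2 - int k = M + 2"
    "int (n + 1) - int k = M + 1"
    "int n - int k = M"
    "int n + 2 - int (Suc k) = M + 1"
    "n + 2 + k = Suc (Suc (n + k))"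
    "n + 1 + k = Suc (n + k)"
    "n + Suc k = Suc (n + k)"
    by (simp_all add: M_def)
  define L where "L = 2 * int k - int n - 2"
  have L_of: "of_int L = 2 * K - N - 2"
    by (simp add: L_def N_def K_def)
  have f: "2 * int k - int (n + 2) = L" "2 * int k - (int n + 2) = L" "2 * int k - int (n + 1) = L + 1"
    "2 * int k - int n = L + 2" "2 * int (Suc k) - (int n + 2) = L + 2"
    by (simp_all add: L_def)
  obtain V where V: "wfact 1 (L + 2) = V" "wfact 1 (L + 1) = (of_int L + 2) * V"
      "wfact 1 L = (of_int L + 2) * (of_int L + 1) * V"
    by (rule wfact_descend2[of 1 L]) auto
  obtain W where W: "wfact 1 (M + 2) = W" "wfact 1 (M + 1) = (of_int M + 2) * W"
      "wfact 1 M = (of_int M + 2) * (of_int M + 1) * W"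
    by (rule wfact_descend2[of 1 M]) auto
  define R where "R = (1 / fact k ^ 2 :: rat)"
  define C where "C = (fact (2 * k) / fact k :: rat)"
  have KR: "of_nat k ^ 2 / fact k ^ 2 = K ^ 2 * R"
    by (simp add: R_def K_def)
  define w where "w = fact (n + k) * C * R * W ^ 2 * V"
  note reduce = KR e W M_of f V L_of R_def[symmetric] C_def[symmetric] fact_Suc w_def N_def K_def
  have F2: "apery_s7_term (n + 2) k = (N + K + 2) * (N + K + 1) * ((2 * K - N) * (2 * K - N - 1)) * w"
    unfolding apery_s7_term_def fact_double_Suc_div unfolding reduce
    by (simp only: of_nat_simps of_nat_numeral of_nat_1)? Groebner_Basis.algebra
  have F1: "apery_s7_term (n + 1) k = (N + K + 1) * (2 * K - N) * (N + 2 - K) ^ 2 * w"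
    unfolding apery_s7_term_def fact_double_Suc_div unfolding reduce
    by (simp only: of_nat_simps of_nat_numeral of_nat_1)? Groebner_Basis.algebra
  have F0: "apery_s7_term n k = ((N + 2 - K) * (N + 1 - K)) ^ 2 * w"
    unfolding apery_s7_term_def fact_double_Suc_div unfolding reduce
    by (simp only: of_nat_simps of_nat_numeral of_nat_1)? Groebner_Basis.algebra
  have G0: "apery_s7_cert n k = ((22 + 15 * N) * K^2 - (78 + 91 * N + 26 * N^2) * K
      + (44 + 72 * N + 39 * N^2 + 7 * N^3)) * K ^ 2 * ((2 * K - N) * (2 * K - N - 1)) * w"
    unfolding apery_s7_cert_def fact_double_Suc_div unfolding reduce
    by (simp only: of_nat_simps of_nat_numeral of_nat_1)? Groebner_Basis.algebra
  have G1: "apery_s7_cert n (Suc k) = ((22 + 15 * N) * (K + 1)^2 - (78 + 91 * N + 26 * N^2) * (K + 1)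
      + (44 + 72 * N + 39 * N^2 + 7 * N^3)) * 2 * (2 * K + 1) * (N + K + 1) * (N + 2 - K) ^ 2 * w"
    unfolding apery_s7_cert_def power_div_fact_Suc fact_double_Suc_div unfolding reduce
    by (simp only: of_nat_simps of_nat_numeral of_nat_1)? Groebner_Basis.algebra
  show ?thesis
    unfolding F2 F1 F0 G0 G1 by (simp add: N_def K_def) Groebner_Basis.algebra
qed

lemma apery_s7_term_int:
  "of_int (int (n choose k) ^ 2 * int (n + k choose k) * int (2 * k choose n)) = apery_s7_term n k"
proof -
  consider "n < k" | "k \<le> n" "2 * k < n" | "k \<le> n" "n \<le> 2 * k" by linarith
  then show ?thesis
  proof cases
    case 3
    then show ?thesis
      using wfact_diff[OF 3(1), of 1] wfact_diff[OF 3(2), of 1]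
      by (simp add: apery_s7_term_def binomial_fact field_simps power2_eq_square)
  qed (simp_all add: apery_s7_term_def binomial_eq_0)
qed

lemma apery_s7_rec: "first_kind_rec (13, 4, -27, 3) apery_s7"
proof (rule first_kind_rec_telescoping[where F = apery_s7_term and G = apery_s7_cert,
    OF _ _ _ _ apery_s7_telescoping])
  show "of_int (apery_s7 n) = sum (apery_s7_term n) {..n}" for n
    unfolding apery_s7_def of_int_sum apery_s7_term_int ..
qed (auto simp: apery_s7_def apery_s7_term_def apery_s7_cert_def)

lemma apery_s7_cong: "[apery_s7 n = 4 ^ n] (mod 2)"
proof -
  have "2 dvd int (n choose k) ^ 2 * int (n + k choose k) * int (2 * k choose n)" if "0 < k" "k \<le> n" for k
    using even_choose_times_choose_add[OF that] by (auto simp: power2_eq_square)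
  from cong_sum_head[OF this, of n "\<lambda>k. k"] have "[apery_s7 n = int (0 choose n)] (mod 2)"
    by (simp add: apery_s7_def)
  moreover have "[int (0 choose n) = 4 ^ n] (mod 2)"
    by (cases n) (auto simp: cong_def)
  ultimately show ?thesis by (rule cong_trans)
qed

definition apery_s10 :: "nat \<Rightarrow> int" where
  "apery_s10 n = (\<Sum>k\<le>n. int (n choose k) ^ 4)"

definition apery_s10_multiplier :: "rat \<Rightarrow> rat \<Rightarrow> rat" where
  "apery_s10_multiplier N K =
    ((16 * N^2 + 36 * N + 20) * K^5 -
     (104 * N^3 + 402 * N^2 + 508 * N + 210) * K^4 +
     (276 * N^4 + 1520 * N^3 + 3088 * N^2 + 2744 * N + 900) * K^3 -
     (374 * N^5 + 2688 * N^4 + 7612 * N^3 + 10620 * N^2 + 7302 * N + 1980) * K^2 +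
     (260 * N^6 + 2316 * N^5 + 8476 * N^4 + 16312 * N^3 + 17412 * N^2 + 9776 * N + 2256) * K -
     (75 * N^7 + 800 * N^6 + 3610 * N^5 + 8930 * N^4 + 13075 * N^3 + 11330 * N^2 + 5380 * N + 1080))"

definition apery_s10_term :: "nat \<Rightarrow> nat \<Rightarrow> rat" where
  "apery_s10_term n k = fact n ^ 4 * (1 / fact k ^ 4) * wfact 1 (int n - int k) ^ 4"

definition apery_s10_cert :: "nat \<Rightarrow> nat \<Rightarrow> rat" where
  "apery_s10_cert n k = apery_s10_multiplier (of_nat n) (of_nat k) * (of_nat k ^ 4 / fact k ^ 4)
      * fact n ^ 4 * wfact 1 (int n + 2 - int k) ^ 4"

lemma apery_s10_telescoping:
  "of_int ((int n + 2)^3) * apery_s10_term (n + 2) k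
        - of_int ((2 * int n + 3) * (6 * (int n + 1)^2 + 6 * (int n + 1) + 2)) * apery_s10_term (n + 1) k
        + of_int ((int n + 1) * ((-64) * (int n + 1)^2 + 4)) * apery_s10_term n k
      = apery_s10_cert n (Suc k) - apery_s10_cert n k"
proof -
  define N K :: rat where "N = of_nat n" and "K = of_nat k"
  define M where "M = int n - int k"
  have M_of: "of_int M = N - K"
    by (simp add: M_def N_def K_def)
  have e: "int (n + 2) - int k = M + 2"
    "int n + 2 - int k = M + 2"
    "int (n + 1) - int k = M + 1"
    "int n - int k = M"
    "int n + 2 - int (Suc k) = M + 1"
    "fact (n + 2) = fact (Suc (Suc n))"
    "fact (n + 1) = fact (Suc n)"
    by (simp_all add: M_def)
  obtain W where W: "wfact 1 (M + 2) = W" "wfact 1 (M + 1) = (of_int M + 2) * W"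
      "wfact 1 M = (of_int M + 2) * (of_int M + 1) * W"
    by (rule wfact_descend2[of 1 M]) auto
  define R where "R = (1 / fact k ^ 4 :: rat)"
  have KR: "of_nat k ^ 4 / fact k ^ 4 = K ^ 4 * R"
    by (simp add: R_def K_def)
  define w where "w = fact n ^ 4 * R * W ^ 4"
  note reduce = KR e W M_of R_def[symmetric] fact_Suc w_def N_def K_def
  have F2: "apery_s10_term (n + 2) k = ((N + 2) * (N + 1)) ^ 4 * w"
    unfolding apery_s10_term_def unfolding reduce
    by (simp only: of_nat_simps of_nat_numeral of_nat_1)? Groebner_Basis.algebra
  have F1: "apery_s10_term (n + 1) k = ((N + 1) * (N + 2 - K)) ^ 4 * w"
    unfolding apery_s10_term_def unfolding reduce
    by (simp only: of_nat_simps of_nat_numeral of_nat_1)? Groebner_Basis.algebra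
  have F0: "apery_s10_term n k = ((N + 2 - K) * (N + 1 - K)) ^ 4 * w"
    unfolding apery_s10_term_def unfolding reduce
    by (simp only: of_nat_simps of_nat_numeral of_nat_1)? Groebner_Basis.algebra
  have G0: "apery_s10_cert n k = apery_s10_multiplier N K * K ^ 4 * w"
    unfolding apery_s10_cert_def unfolding reduce
    by (simp only: of_nat_simps of_nat_numeral of_nat_1)? Groebner_Basis.algebra
  have G1: "apery_s10_cert n (Suc k) = apery_s10_multiplier N (1 + K) * (N + 2 - K) ^ 4 * w"
    unfolding apery_s10_cert_def power_div_fact_Suc unfolding reduce
    by (simp only: of_nat_simps of_nat_numeral of_nat_1)? Groebner_Basis.algebra
  show ?thesis
    unfolding F2 F1 F0 G0 G1 apery_s10_multiplier_def by (simp add: N_def K_def) Groebner_Basis.algebra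
qed

lemma apery_s10_term_int: "of_int (int (n choose k) ^ 4) = apery_s10_term n k"
proof (cases "k \<le> n")
  case True
  then show ?thesis
    using wfact_diff[OF True, of 1]
    by (simp add: apery_s10_term_def binomial_fact power_divide power_mult_distrib)
qed (simp add: apery_s10_term_def binomial_eq_0)

lemma apery_s10_rec: "first_kind_rec (6, 2, -64, 4) apery_s10"
proof (rule first_kind_rec_telescoping[where F = apery_s10_term and G = apery_s10_cert,
    OF _ _ _ _ apery_s10_telescoping])
  show "of_int (apery_s10 n) = sum (apery_s10_term n) {..n}" for n
    unfolding apery_s10_def of_int_sum apery_s10_term_int ..
qed (auto simp: apery_s10_def apery_s10_term_def apery_s10_cert_def)

lemma apery_s10_cong: "[apery_s10 n = 2 ^ n] (mod 2)"
proof -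
  have "[apery_s10 n = (\<Sum>k\<le>n. int (n choose k))] (mod 2)"
    unfolding apery_s10_def by (rule cong_sum) (simp add: cong_iff_dvd_diff)
  also have "(\<Sum>k\<le>n. int (n choose k)) = 2 ^ n"
    using choose_row_sum[of n] by (metis of_nat_sum of_nat_numeral of_nat_power)
  finally show ?thesis .
qed

text \<open>
  The coefficient form of
  \<open>(1 - 12 * x) powr (- 1 / 2) * (\<Sum>k. (4 * k)! / k! ^ 4 * (x ^ 3 / (1 - 12 * x)\<^sup>2) ^ k)\<close>.
\<close>

definition apery_s18 :: "nat \<Rightarrow> int" where
  "apery_s18 n = (\<Sum>k\<le>n. int (n - k choose (2 * k)) * int (2 * k choose k) ^ 2
      * int (2 * (n - k) choose (n - k)) * 3 ^ (n - 3 * k))"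

definition apery_s18_term :: "nat \<Rightarrow> nat \<Rightarrow> rat" where
  "apery_s18_term n k = (fact (2 * k) / fact k) * (1 / fact k ^ 3) * (fact (2 * (n - k)) / fact (n - k))
      * wfact 3 (int n - 3 * int k)"

definition apery_s18_cert :: "nat \<Rightarrow> nat \<Rightarrow> rat" where
  "apery_s18_cert n k = - (72 * of_nat n + 90) * (of_nat k ^ 3 / fact k ^ 3) * (fact (2 * k) / fact k)
      * (fact (2 * (n + 1 - k)) / fact (n + 1 - k)) * wfact 3 (int n + 2 - 3 * int k)"

lemma apery_s18_telescoping:
  "of_int ((int n + 2)^3) * apery_s18_term (n + 2) k
        - of_int ((2 * int n + 3) * (14 * (int n + 1)^2 + 14 * (int n + 1) + 6)) * apery_s18_term (n + 1) k
        + of_int ((int n + 1) * (192 * (int n + 1)^2 + (-12))) * apery_s18_term n k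
      = apery_s18_cert n (Suc k) - apery_s18_cert n k" if kn: "k \<le> n"
proof -
  define N K :: rat where "N = of_nat n" and "K = of_nat k"
  define M where "M = int n - 1 - 3 * int k"
  have M_of: "of_int M = N - 1 - 3 * K"
    by (simp add: M_def N_def K_def)
  have e: "int (n + 2) - 3 * int k = M + 3"
    "int n + 2 - 3 * int k = M + 3"
    "int (n + 1) - 3 * int k = M + 2"
    "int n - 3 * int k = M + 1"
    "int n + 2 - 3 * int (Suc k) = M"
    by (simp_all add: M_def)
  define H where "H = (fact (2 * (n - k)) / fact (n - k) :: rat)"
  have m: "n + 2 - k = Suc (Suc (n - k))" "n + 1 - k = Suc (n - k)" "n + 1 - Suc k = n - k"
    using kn by simp_all
  have m_of: "of_nat (Suc (n - k)) = N - K + 1" "of_nat (n - k) = N - K"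
    using kn by (simp_all add: N_def K_def)
  obtain W where W: "wfact 3 (M + 3) = 3^3 * W" "wfact 3 (M + 2) = 3^2 * (of_int M + 3) * W"
      "wfact 3 (M + 1) = 3 * (of_int M + 3) * (of_int M + 2) * W"
      "wfact 3 M = (of_int M + 3) * (of_int M + 2) * (of_int M + 1) * W"
    by (rule wfact_descend3[of 3 M]) auto
  define R where "R = (1 / fact k ^ 3 :: rat)"
  define C where "C = (fact (2 * k) / fact k :: rat)"
  have KR: "of_nat k ^ 3 / fact k ^ 3 = K ^ 3 * R"
    by (simp add: R_def K_def)
  define w where "w = C * R * H * W"
  note reduce = KR e W M_of m H_def[symmetric] m_of R_def[symmetric] C_def[symmetric] fact_Suc w_def N_def K_def
  have F2: "apery_s18_term (n + 2) k = 27 * (2 * (2 * (N - K) + 3) * (2 * (2 * (N - K) + 1))) * w"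
    unfolding apery_s18_term_def m fact_double_Suc_div unfolding reduce
    by (simp only: of_nat_simps of_nat_numeral of_nat_1)? Groebner_Basis.algebra
  have F1: "apery_s18_term (n + 1) k = 9 * (2 * (2 * (N - K) + 1)) * (N + 2 - 3 * K) * w"
    unfolding apery_s18_term_def m fact_double_Suc_div unfolding reduce
    by (simp only: of_nat_simps of_nat_numeral of_nat_1)? Groebner_Basis.algebra
  have F0: "apery_s18_term n k = 3 * (N + 2 - 3 * K) * (N + 1 - 3 * K) * w"
    unfolding apery_s18_term_def m fact_double_Suc_div unfolding reduce
    by (simp only: of_nat_simps of_nat_numeral of_nat_1)? Groebner_Basis.algebra
  have G0: "apery_s18_cert n k = - 27 * (72 * N + 90) * (2 * (2 * (N - K) + 1)) * K ^ 3 * w"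
    unfolding apery_s18_cert_def m fact_double_Suc_div unfolding reduce
    by (simp only: of_nat_simps of_nat_numeral of_nat_1)? Groebner_Basis.algebra
  have G1: "apery_s18_cert n (Suc k) = - (72 * N + 90) * 2 * (2 * K + 1) * (N + 2 - 3 * K) * (N + 1 - 3 * K)
      * (N - 3 * K) * w"
    unfolding apery_s18_cert_def power_div_fact_Suc m fact_double_Suc_div unfolding reduce
    by (simp only: of_nat_simps of_nat_numeral of_nat_1)? Groebner_Basis.algebra
  show ?thesis
    unfolding F2 F1 F0 G0 G1 by (simp add: N_def K_def) Groebner_Basis.algebra
qed

lemma apery_s18_term_int:
  "of_int (int (n - k choose (2 * k)) * int (2 * k choose k) ^ 2
      * int (2 * (n - k) choose (n - k)) * 3 ^ (n - 3 * k)) = apery_s18_term n k"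
proof (cases "3 * k \<le> n")
  case True
  then have "n - k - 2 * k = n - 3 * k" "2 * (n - k) - (n - k) = n - k" "2 * k - k = k" "2 * k \<le> n - k" by auto
  then show ?thesis
    using wfact_diff[OF True, of 3]
    by (simp add: apery_s18_term_def binomial_fact power2_eq_square power3_eq_cube del: diff_mult_distrib2)
next
  case False
  then have "wfact 3 (int n - 3 * int k) = 0" by simp
  with False show ?thesis by (simp add: apery_s18_term_def binomial_eq_0)
qed

lemma apery_s18_rec: "first_kind_rec (14, 6, 192, -12) apery_s18"
proof (rule first_kind_rec_telescoping[where F = apery_s18_term and G = apery_s18_cert])
  show "of_int (apery_s18 n) = sum (apery_s18_term n) {..n}" for n
    unfolding apery_s18_def of_int_sum apery_s18_term_int ..
  show "of_int ((int n + 2)^3) * apery_s18_term (n + 2) k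
        - of_int ((2 * int n + 3) * (14 * (int n + 1)^2 + 14 * (int n + 1) + 6)) * apery_s18_term (n + 1) k
        + of_int ((int n + 1) * (192 * (int n + 1)^2 + (-12))) * apery_s18_term n k
      = apery_s18_cert n (Suc k) - apery_s18_cert n k" for n k
  proof (cases "k \<le> n")
    case True
    then show ?thesis by (rule apery_s18_telescoping)
  qed (simp add: apery_s18_term_def apery_s18_cert_def)
qed (auto simp: apery_s18_def apery_s18_term_def apery_s18_cert_def eval_nat_numeral)

text \<open>
  Modulo 3 only \<open>n = 3 * k\<close> matters, because of the power of 3; in that case the summand is the
  multinomial coefficient \<open>(4 * k)! / k! ^ 4\<close>.
\<close>

lemma apery_s18_summand_dvd:
  assumes "0 < n" "k \<le> n"
  shows "6 dvd int (n - k choose (2 * k)) * int (2 * k choose k) ^ 2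
      * int (2 * (n - k) choose (n - k)) * 3 ^ (n - 3 * k)" (is "6 dvd ?t")
proof -
  consider "n < 3 * k" | "3 * k < n" | "n = 3 * k" by linarith
  then show ?thesis
  proof cases
    case 1
    then show ?thesis by (simp add: binomial_eq_0)
  next
    case 2
    have "(3::int) dvd 3 ^ (n - 3 * k)" using 2 by (simp add: dvd_power)
    then have "2 * 3 dvd int (2 * (n - k) choose (n - k)) * 3 ^ (n - 3 * k)"
      using 2 by (intro mult_dvd_mono two_dvd_central) auto
    then show ?thesis
      using dvd_mult[of 6 _ "int (n - k choose (2 * k)) * int (2 * k choose k) ^ 2"]
      by (simp add: mult.assoc)
  next
    case 3
    then have k: "0 < k" using assms by simp
    have e: "n - k = 2 * k" "n - 3 * k = 0" using 3 by auto
    have "(2 * (2 * k) choose (2 * k)) * (2 * k choose k) = (4 * k choose k) * (3 * k choose k)"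
      using choose_mult[of k "2 * k" "4 * k"] by simp
    then have "int (2 * (2 * k) choose (2 * k)) * int (2 * k choose k)
        = int (4 * k choose k) * int (3 * k choose k)"
      by (metis of_nat_mult)
    then have "?t = int (4 * k choose k) * (int (3 * k choose k) * int (2 * k choose k))"
      unfolding e by (simp add: power2_eq_square mult_ac)
    then show ?thesis using six_dvd_multinomial[OF k] by simp
  qed
qed

lemma apery_s18_cong: "[apery_s18 n = 6 ^ n] (mod 6)"
proof (cases "n = 0")
  case False
  then have "6 dvd apery_s18 n"
    unfolding apery_s18_def by (intro dvd_sum apery_s18_summand_dvd) auto
  moreover have "(6::int) dvd 6 ^ n" using False by (simp add: dvd_power)
  ultimately show ?thesis by (simp add: cong_iff_dvd_diff)
qed (simp add: apery_s18_def)

section \<open>Binomial transforms of sequences of the second kind\<close>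

text \<open>
  The telescoping here is for a summand whose factor \<open>u k\<close> is only known through its recurrence: the
  certificate involves \<open>u k\<close> and \<open>u (k - 1)\<close>, and in the difference the value \<open>u (k + 1)\<close> is eliminated by the
  recurrence.
\<close>

lemma binomial_transform_telescoping:
  fixes u :: "nat \<Rightarrow> int" and X :: int and n k :: nat
  assumes X: "X \<noteq> 0" "X\<^sup>2 + A * X + B = 0"
    and u: "second_kind_rec (A, B, l) u"
  defines "F \<equiv> \<lambda>n k. fact n / fact k * wfact (of_int X) (int n - int k) * of_int (u k)"
    and "G \<equiv> \<lambda>n k. (of_nat n + 1) * fact n / fact k * of_nat k ^ 2 *
      (of_int B * wfact (of_int X) (int n + 1 - int k) * of_int (prev u k)
        - of_nat k * wfact (of_int X) (int n + 2 - int k) * of_int (u k))"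
  shows "of_int ((int n + 2)^2) * F (n + 2) k
        - of_int ((A + 3 * X) * (int n + 1)^2 + (A + 3 * X) * (int n + 1) + (l + X)) * F (n + 1) k
        + of_int (X * (2 * X + A) * (int n + 1)^2) * F n k = G n (Suc k) - G n k"
proof -
  define N K x a b c :: rat where "N = of_nat n" and "K = of_nat k" and "x = of_int X"
    and "a = of_int A" and "b = of_int B" and "c = of_int l"
  define f :: rat where "f = fact n / fact k"
  define u0 u1 u2 :: rat where "u0 = of_int (prev u k)" and "u1 = of_int (u k)" and "u2 = of_int (u (Suc k))"
  define M where "M = int n - int k"
  have M_of: "of_int M = N - K" by (simp add: M_def N_def K_def)
  have e: "int (n + 2) - int k = M + 2" "int n + 2 - int k = M + 2" "int (n + 1) - int k = M + 1"
    "int n + 1 - int k = M + 1" "int n + 2 - int (Suc k) = M + 1" "int n + 1 - int (Suc k) = M"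
    "prev u (Suc k) = u k"
    by (simp_all add: M_def prev_def)
  obtain W where W: "wfact x (M + 2) = x\<^sup>2 * W" "wfact x (M + 1) = x * (of_int M + 2) * W"
      "wfact x M = (of_int M + 2) * (of_int M + 1) * W"
    using X(1) by (auto simp: x_def intro: wfact_descend2[of x M])
  have x: "x\<^sup>2 + a * x + b = 0"
    using X(2) unfolding x_def a_def b_def by (metis of_int_0 of_int_add of_int_mult of_int_power)
  have rec: "(K + 1)\<^sup>2 * u2 = (a * K\<^sup>2 + a * K + c) * u1 - b * K\<^sup>2 * u0"
  proof -
    have "(int k + 1)^2 * u (Suc k) = (A * int k ^ 2 + A * int k + l) * u k - B * int k ^ 2 * prev u k"
      using u by (simp add: second_kind_rec_def algebra_simps)
    then have "rat_of_int ((int k + 1)^2 * u (Suc k)) = of_int ((A * int k ^ 2 + A * int k + l) * u k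
        - B * int k ^ 2 * prev u k)"
      by simp
    then show ?thesis by (simp add: K_def a_def b_def c_def u0_def u1_def u2_def)
  qed
  have facts: "fact (n + 2) = (N + 2) * (N + 1) * fact n" "fact (n + 1) = (N + 1) * fact n"
    by (simp_all add: N_def algebra_simps)
  have F2: "F (n + 2) k = (N + 2) * (N + 1) * f * x\<^sup>2 * W * u1"
    unfolding F_def e x_def[symmetric] W u1_def[symmetric] facts by (simp add: f_def)
  have F1: "F (n + 1) k = (N + 1) * f * x * (N - K + 2) * W * u1"
    unfolding F_def e x_def[symmetric] W M_of u1_def[symmetric] facts by (simp add: f_def)
  have F0: "F n k = f * (N - K + 2) * (N - K + 1) * W * u1"
    unfolding F_def e M_def[symmetric] x_def[symmetric] W M_of u1_def[symmetric] by (simp add: f_def)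
  have G0: "G n k = (N + 1) * f * K\<^sup>2 * (b * (x * (N - K + 2) * W) * u0 - K * (x\<^sup>2 * W) * u1)"
    unfolding G_def e x_def[symmetric] W M_of u1_def[symmetric] u0_def[symmetric]
        by (simp add: f_def N_def K_def b_def)
  have fK: "fact n / fact (Suc k) * rat_of_nat (Suc k) = f"
    unfolding f_def by (simp del: of_nat_Suc)
  have "G n (Suc k) = (N + 1) * (fact n / fact (Suc k) * rat_of_nat (Suc k)) * (K + 1) *
      (b * ((N - K + 2) * (N - K + 1) * W) * u1 - (K + 1) * (x * (N - K + 2) * W) * u2)"
    unfolding G_def e x_def[symmetric] W M_of u1_def[symmetric] u2_def[symmetric]
    by (simp add: N_def K_def b_def power2_eq_square mult_ac add_ac)
  then have "G n (Suc k) = (N + 1) * f *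
      (b * ((N - K + 2) * (N - K + 1) * W) * (K + 1) * u1 - (x * (N - K + 2) * W) * ((K + 1)\<^sup>2 * u2))"
    unfolding fK by (simp add: algebra_simps power2_eq_square)
  then have G1: "G n (Suc k) - G n k = (N + 1) * f * W * u1 * (N - K + 2) *
      (b * (N - K + 1) * (K + 1) - x * (a * K\<^sup>2 + a * K + c)) + (N + 1) * f * W * u1 * K\<^sup>2 * K * x\<^sup>2"
    unfolding rec G0 by (simp add: algebra_simps)
  have b: "b = - (x\<^sup>2 + a * x)" using x by (simp add: eq_neg_iff_add_eq_0 add.commute)
  have poly: "(N + 2)\<^sup>2 * (N + 2) * x\<^sup>2
        - ((a + 3 * x) * (N + 1)\<^sup>2 + (a + 3 * x) * (N + 1) + (c + x)) * x * (N - K + 2)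
        + (x * (2 * x + a) * (N + 1)) * (N - K + 2) * (N - K + 1)
      = (N - K + 2) * (- (x\<^sup>2 + a * x) * (N - K + 1) * (K + 1) - x * (a * K\<^sup>2 + a * K + c)) + K\<^sup>2 * K * x\<^sup>2"
    by Groebner_Basis.algebra
  have "(N + 2)\<^sup>2 * F (n + 2) k
        - ((a + 3 * x) * (N + 1)\<^sup>2 + (a + 3 * x) * (N + 1) + (c + x)) * F (n + 1) k
        + (x * (2 * x + a) * (N + 1)\<^sup>2) * F n k
      = (N + 1) * f * W * u1 * ((N + 2)\<^sup>2 * (N + 2) * x\<^sup>2
        - ((a + 3 * x) * (N + 1)\<^sup>2 + (a + 3 * x) * (N + 1) + (c + x)) * x * (N - K + 2)
        + (x * (2 * x + a) * (N + 1)) * (N - K + 2) * (N - K + 1))"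
    unfolding F2 F1 F0 by (simp add: algebra_simps power2_eq_square)
  also have "\<dots> = G n (Suc k) - G n k"
    unfolding poly G1 b by (simp add: algebra_simps)
  finally have "(N + 2)\<^sup>2 * F (n + 2) k
        - ((a + 3 * x) * (N + 1)\<^sup>2 + (a + 3 * x) * (N + 1) + (c + x)) * F (n + 1) k
        + (x * (2 * x + a) * (N + 1)\<^sup>2) * F n k = G n (Suc k) - G n k" .
  then show ?thesis by (simp add: N_def x_def a_def c_def)
qed

text \<open>
  The generating function of the transform is \<open>1 / (1 - X * x) * U(x / (1 - X * x))\<close>, and in the coordinate
  \<open>1 / x\<close> the substitution is a translation by \<open>X\<close>. The differential equation for \<open>U\<close> has its
  singularities at 0, at infinity and at the two roots of \<open>y\<^sup>2 - A * y + B\<close> in this coordinate. If \<open>- X\<close> is one of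
  these roots, the translation moves it to 0, so that 0 and infinity are again among the singularities.
\<close>

theorem binomial_transform_second_kind:
  assumes X: "X \<noteq> 0" "X\<^sup>2 + A * X + B = 0"
    and u: "second_kind_rec (A, B, l) u"
  shows "second_kind_rec (A + 3 * X, X * (2 * X + A), l + X) (binomial_transform u (- X))"
proof (rule second_kind_rec_telescoping)
  show "binomial_transform u (- X) 0 = 1" "binomial_transform u (- X) 1 = l + X"
    using u by (simp_all add: binomial_transform_def second_kind_rec_iff)
  show "of_int (binomial_transform u (- X) n)
      = (\<Sum>k\<le>n. fact n / fact k * wfact (of_int X) (int n - int k) * of_int (u k))" for n
    unfolding binomial_transform_def of_int_sum
    by (rule sum.cong) (auto simp: wfact_diff binomial_fact)
qed (rule binomial_transform_telescoping[OF X u] | simp)+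

lemma binomial_transform_power:
  fixes x c :: "'a :: comm_ring_1"
  shows "binomial_transform (\<lambda>k. c ^ k) x n = (c - x) ^ n"
  using binomial_ring[of c "- x" n]
  by (simp add: binomial_transform_def mult_ac atLeast0AtMost)

lemma binomial_transform_cong:
  fixes u v :: "nat \<Rightarrow> int"
  assumes "\<And>k. [u k = v k] (mod m)"
  shows "[binomial_transform u x n = binomial_transform v x n] (mod m)"
  unfolding binomial_transform_def by (intro cong_sum cong_mult cong_refl assms)

definition zagier_C :: "nat \<Rightarrow> int" where
  "zagier_C = binomial_transform franel (- 1)"

lemma zagier_C_rec: "second_kind_rec (10, 9, 3) zagier_C"
  using binomial_transform_second_kind[OF _ _ franel_rec, of 1] by (simp add: zagier_C_def)

lemma zagier_C_cong: "[zagier_C n = 3 ^ n] (mod 6)"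
  using binomial_transform_cong[of franel "\<lambda>k. 2 ^ k" 6 "- 1" n, OF franel_cong]
  by (simp add: zagier_C_def binomial_transform_power)

definition zagier_F :: "nat \<Rightarrow> int" where
  "zagier_F n = (- 1) ^ n * binomial_transform franel 8 n"

text \<open>
  This is the substitution of \<open>- x\<close> for \<open>x\<close> in the generating function.
\<close>

lemma second_kind_rec_alternating:
  assumes "second_kind_rec (A, B, l) u"
  shows "second_kind_rec (- A, B, - l) (\<lambda>n. (- 1) ^ n * u n)"
proof -
  have "(int n + 2)\<^sup>2 * u (n + 2) = (A * (int n + 1)\<^sup>2 + A * (int n + 1) + l) * u (n + 1)
      - B * (int n + 1)\<^sup>2 * u n" for n
    using assms by (simp add: second_kind_rec_iff algebra_simps)
  then have "(int n + 2)\<^sup>2 * ((- 1) ^ (n + 2) * u (n + 2)) = (- 1) ^ n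
      * ((A * (int n + 1)\<^sup>2 + A * (int n + 1) + l) * u (n + 1) - B * (int n + 1)\<^sup>2 * u n)" for n
    by simp
  then show ?thesis
    using assms by (simp add: second_kind_rec_iff algebra_simps)
qed

lemma zagier_F_rec: "second_kind_rec (17, 72, 6) zagier_F"
  using second_kind_rec_alternating[OF binomial_transform_second_kind[OF _ _ franel_rec, of "- 8"]]
  by (simp add: zagier_F_def[abs_def])

lemma zagier_F_cong: "[zagier_F n = 6 ^ n] (mod 6)"
proof -
  have "[zagier_F n = (- 1) ^ n * (2 - 8) ^ n] (mod 6)"
    using binomial_transform_cong[of franel "\<lambda>k. 2 ^ k" 6 8 n, OF franel_cong]
    unfolding zagier_F_def binomial_transform_power by (intro cong_mult cong_refl)
  also have "(- 1) ^ n * (2 - 8) ^ n = (6 ^ n :: int)"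
    by (simp flip: power_mult_distrib)
  finally show ?thesis .
qed

section \<open>Lucas congruences for the sequence D\<close>

lemma choose_add_prime_cong:
  assumes "prime p"
  shows "[p + n choose k = (n choose k) + (if p \<le> k then n choose (k - p) else 0)] (mod p)"
proof -
  have p: "0 < p" using assms by (rule prime_gt_0_nat)
  have "[(p choose j) * (n choose (k - j))
       = (if j = 0 then n choose k else 0) + (if j = p then n choose (k - p) else 0)] (mod p)" for j
  proof -
    consider "j = 0" | "j = p" | "p < j" | "0 < j" "j < p" by linarith
    then show ?thesis
    proof cases
      case 4
      then show ?thesis using dvd_choose_prime[of j p] assms by (simp add: cong_0_iff)
    qed (use p in \<open>auto simp: binomial_eq_0\<close>)
  qed
  then have "[(\<Sum>j\<le>k. (p choose j) * (n choose (k - j)))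
       = (\<Sum>j\<le>k. (if j = 0 then n choose k else 0) + (if j = p then n choose (k - p) else 0))] (mod p)"
    by (intro cong_sum) auto
  then show ?thesis
    by (simp add: vandermonde sum.distrib)
qed

text \<open>
  Induction on \<open>a\<close>: adding \<open>p\<close> to the upper index acts, modulo \<open>p\<close>, like Pascal's rule on the leading
  digits.
\<close>

theorem Lucas_choose_cong:
  assumes "prime p" "b < p" "d < p"
  shows "[p * a + b choose (p * c + d) = (a choose c) * (b choose d)] (mod p)"
proof (induction a arbitrary: c)
  case 0
  show ?case
  proof (cases c)
    case (Suc c')
    then have "b < p * c + d" using assms by simp
    then show ?thesis using Suc by (simp add: binomial_eq_0)
  qed simp
next
  case (Suc a)
  have e: "p * Suc a + b = p + (p * a + b)" by simp
  show ?case
  proof (cases c)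
    case 0
    then show ?thesis
      using choose_add_prime_cong[OF assms(1), of "p * a + b" d] Suc[of 0] assms
      unfolding e by (simp add: cong_def)
  next
    case (Suc c')
    have "[p * Suc a + b choose (p * c + d)
         = (p * a + b choose (p * c + d)) + (p * a + b choose (p * c' + d))] (mod p)"
      using choose_add_prime_cong[OF assms(1), of "p * a + b" "p * c + d"]
      unfolding e by (simp add: Suc)
    also have "[(p * a + b choose (p * c + d)) + (p * a + b choose (p * c' + d))
         = (a choose c) * (b choose d) + (a choose c') * (b choose d)] (mod p)"
      by (intro cong_add Suc.IH)
    also have "(a choose c) * (b choose d) + (a choose c') * (b choose d) = (Suc a choose c) * (b choose d)"
      by (simp add: Suc algebra_simps)
    finally show ?thesis .
  qed
qed

definition zagier_D_summand :: "nat \<Rightarrow> nat \<Rightarrow> nat" where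
  "zagier_D_summand n k = (n choose k)\<^sup>2 * (n + k choose k)"

text \<open>
  Already the single summands are multiplicative in the digits. The factor \<open>r choose s\<close> settles the case
  \<open>s > r\<close>.
\<close>

lemma zagier_D_summand_Lucas:
  assumes p: "prime p" and r: "r < p" and s: "s < p"
  shows "[zagier_D_summand (p * m + r) (p * k + s) = zagier_D_summand m k * zagier_D_summand r s] (mod p)"
proof -
  have first: "[(p * m + r choose (p * k + s))\<^sup>2 = ((m choose k) * (r choose s))\<^sup>2] (mod p)"
    by (intro cong_pow Lucas_choose_cong assms)
  show ?thesis
  proof (cases "r < s")
    case True
    then show ?thesis
      using cong_mult[OF first cong_refl, of "p * m + r + (p * k + s) choose (p * k + s)"]
      by (simp add: zagier_D_summand_def binomial_eq_0)
  next
    case False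
    have second: "[p * m + r + (p * k + s) choose (p * k + s) = (m + k choose k) * (r + s choose s)] (mod p)"
    proof (cases "r + s < p")
      case True
      have "p * m + r + (p * k + s) = p * (m + k) + (r + s)" by (simp add: algebra_simps)
      then show ?thesis using Lucas_choose_cong[OF p True s, of "m + k" k] by (simp only:)
    next
      \<comment> \<open>a carry out of the last digit makes both sides vanish\<close>
      case False
      define t where "t = r + s - p"
      have t: "t < p" "t < s" using False r s by (auto simp: t_def)
      have "p * m + r + (p * k + s) = p * (m + k + 1) + t" "r + s = p * 1 + t"
        using False by (simp_all add: algebra_simps t_def)
      moreover have "[p * (m + k + 1) + t choose (p * k + s) = 0] (mod p)"
        using Lucas_choose_cong[OF p t(1) s, of "m + k + 1" k] t(2) by (simp add: binomial_eq_0)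
      moreover have "[p * 1 + t choose s = 0] (mod p)"
        using Lucas_choose_cong[OF p t(1) s, of 1 0] t(2) by (simp add: binomial_eq_0)
      ultimately show ?thesis
        by (simp only: cong_0_iff) (simp add: cong_def)
    qed
    show ?thesis
      using cong_mult[OF first second] by (simp add: zagier_D_summand_def power_mult_distrib mult_ac)
  qed
qed

lemma zagier_D_eq_sum_summand:
  "n < N \<Longrightarrow> zagier_D n = int (\<Sum>k<N. zagier_D_summand n k)"
proof -
  assume "n < N"
  have "(\<Sum>k\<le>n. zagier_D_summand n k) = (\<Sum>k<N. zagier_D_summand n k)"
    using \<open>n < N\<close> by (intro sum.mono_neutral_left) (auto simp: zagier_D_summand_def)
  moreover have "zagier_D n = int (\<Sum>k\<le>n. zagier_D_summand n k)"
    by (simp add: zagier_D_def zagier_D_summand_def)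
  ultimately show ?thesis by simp
qed

theorem zagier_D_Lucas:
  assumes p: "prime p" and r: "r < p"
  shows "[zagier_D (p * m + r) = zagier_D m * zagier_D r] (mod int p)"
proof -
  have block: "sum f {k * p..<k * p + p} = (\<Sum>s<p. f (k * p + s))" for f :: "nat \<Rightarrow> nat" and k
    using sum.atLeastLessThan_shift_0[of f "k * p" "k * p + p"] by (simp add: atLeast0LessThan)
  have "(\<Sum>k<Suc m * p. zagier_D_summand (p * m + r) k)
      = (\<Sum>k<Suc m. \<Sum>s<p. zagier_D_summand (p * m + r) (p * k + s))"
    by (simp only: sum.nat_group[symmetric] block mult.commute[of p])
  also have "[\<dots> = (\<Sum>k<Suc m. \<Sum>s<p. zagier_D_summand m k * zagier_D_summand r s)] (mod p)"
    by (intro cong_sum zagier_D_summand_Lucas p r) simp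
  also have "(\<Sum>k<Suc m. \<Sum>s<p. zagier_D_summand m k * zagier_D_summand r s)
      = (\<Sum>k<Suc m. zagier_D_summand m k) * (\<Sum>s<p. zagier_D_summand r s)"
    by (simp only: sum_product)
  finally have "[int (\<Sum>k<Suc m * p. zagier_D_summand (p * m + r) k)
      = int ((\<Sum>k<Suc m. zagier_D_summand m k) * (\<Sum>s<p. zagier_D_summand r s))] (mod int p)"
    by (simp only: cong_int_iff)
  moreover have "p * m + r < Suc m * p" using r by simp
  ultimately show ?thesis
    using zagier_D_eq_sum_summand[of "p * m + r" "Suc m * p"] zagier_D_eq_sum_summand[of m "Suc m"]
      zagier_D_eq_sum_summand[OF r] by simp
qed

lemma zagier_D_cong_5: "[zagier_D n = 3 ^ n] (mod 5)"
proof (induction n rule: less_induct)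
  case (less n)
  have digit: "[zagier_D r = 3 ^ r] (mod 5)" if "r < 5" for r
  proof -
    have "r \<in> {0, 1, 2, 3, 4}" using that by auto
    then show ?thesis by (auto simp: zagier_D_def cong_def eval_nat_numeral)
  qed
  show ?case
  proof (cases "n < 5")
    case False
    define m r where "m = n div 5" and "r = n mod 5"
    have n: "n = 5 * m + r" and r: "r < 5" and m: "m < n"
      using False by (simp_all add: m_def r_def)
    have "[zagier_D n = zagier_D m * zagier_D r] (mod 5)"
      using zagier_D_Lucas[of 5 r m] r n by simp
    also have "[zagier_D m * zagier_D r = 3 ^ m * 3 ^ r] (mod 5)"
      by (intro cong_mult less m digit r)
    also have "[3 ^ m * 3 ^ r = (3 ^ 5) ^ m * (3 ^ r :: int)] (mod 5)"
      by (intro cong_mult cong_pow cong_refl) (simp add: cong_def)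
    also have "(3 ^ 5) ^ m * 3 ^ r = (3 ^ n :: int)"
      by (simp add: n power_add power_mult del: power_numeral)
    finally show ?thesis .
  qed (rule digit)
qed

lemma zagier_D_cong_2: "[zagier_D n = 3 ^ n] (mod 2)"
proof -
  have "2 dvd int (n choose k) ^ 2 * int (n + k choose k)" if "0 < k" "k \<le> n" for k
    using even_choose_times_choose_add[OF that] by (auto simp: power2_eq_square)
  from cong_sum_head[OF this, of n "\<lambda>k. k"] have "[zagier_D n = 1] (mod 2)"
    by (simp add: zagier_D_def)
  moreover have "[1 = 3 ^ n] (mod (2::int))"
    using cong_pow[of 1 3 "2::int" n] by (simp add: cong_def)
  ultimately show ?thesis by (rule cong_trans)
qed

lemma zagier_D_cong: "[zagier_D n = 3 ^ n] (mod 10)"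
proof -
  have "[zagier_D n = 3 ^ n] (mod (2 * 5))"
    by (rule coprime_cong_mult[OF zagier_D_cong_2 zagier_D_cong_5]) simp
  then show ?thesis by simp
qed

section \<open>A quadratic transformation between the two kinds\<close>

unbundle fps_syntax

text \<open>
  The Euler operator \<open>x * d/dx\<close>. It multiplies the coefficient of \<open>x ^ n\<close> by \<open>n\<close>, so a recurrence with
  polynomial coefficients is the same as a differential equation in \<open>theta\<close>.
\<close>

definition theta :: "rat fps \<Rightarrow> rat fps" where
  "theta f = fps_X * fps_deriv f"

lemma theta_nth: "theta f $ n = of_nat n * f $ n"
  by (cases n) (simp_all add: theta_def)

lemma theta_simps [simp]:
  "theta (f + g) = theta f + theta g"
  "theta (f - g) = theta f - theta g"
  "theta (- f) = - theta f"
  "theta (f * g) = theta f * g + f * theta g"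
  "theta fps_X = fps_X"
  "theta (fps_const c) = 0"
  "theta 1 = 0"
  "theta (numeral k) = 0"
  by (simp_all add: theta_def algebra_simps)

lemma theta_compose:
  assumes "w $ 0 = 0"
  shows "theta (g oo w) * w = (theta g oo w) * theta w"
  using assms by (simp add: theta_def fps_compose_deriv fps_compose_mult_distrib mult_ac)

lemma fps_compose_eq_0_imp:
  fixes g w :: "rat fps"
  assumes w: "w $ 0 = 0" "w $ 1 \<noteq> 0" and "g oo w = 0"
  shows "g = 0"
proof -
  have "g = g oo (w oo fps_inv w)" using fps_inv_right[OF w] by simp
  also have "\<dots> = (g oo w) oo fps_inv w"
    by (rule fps_compose_assoc) (simp_all add: w fps_inv_def)
  also have "\<dots> = 0" using assms(3) by simp
  finally show ?thesis .
qed

definition int_series :: "(nat \<Rightarrow> int) \<Rightarrow> rat fps" where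
  "int_series u = Abs_fps (\<lambda>n. of_int (u n))"

lemma int_series_nth [simp]: "int_series u $ n = of_int (u n)"
  by (simp add: int_series_def)

lemma second_kind_ode:
  fixes A B l :: int
  assumes u: "second_kind_rec (A, B, l) u"
  defines "a \<equiv> fps_const (of_int A)" and "b \<equiv> fps_const (of_int B)" and "c \<equiv> fps_const (of_int l)"
    and "f \<equiv> int_series u"
  shows "theta (theta f) = fps_X * (a * (theta (theta f) + theta f) + c * f)
           - fps_X * (fps_X * (b * (theta (theta f) + 2 * theta f + f)))"
proof (rule fps_ext)
  fix n
  have rec: "of_int ((int m + 1)^2 * u (Suc m)) = (of_int ((A * int m ^ 2 + A * int m + l) * u m
            - B * int m ^ 2 * prev u m) :: rat)" for m
  proof (rule arg_cong[where f = rat_of_int])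
    show "(int m + 1)^2 * u (Suc m) = (A * int m ^ 2 + A * int m + l) * u m - B * int m ^ 2 * prev u m"
      using u by (simp add: second_kind_rec_def algebra_simps)
  qed
  show "theta (theta f) $ n = (fps_X * (a * (theta (theta f) + theta f) + c * f)
           - fps_X * (fps_X * (b * (theta (theta f) + 2 * theta f + f)))) $ n"
  proof (cases n)
    case (Suc m)
    show ?thesis
    proof (cases m)
      case 0
      then show ?thesis using Suc rec[of 0] u
        by (simp add: theta_nth a_def b_def c_def f_def second_kind_rec_def)
    next
      case (Suc j)
      then show ?thesis using \<open>n = Suc m\<close> rec[of m]
        by (simp add: theta_nth a_def b_def c_def f_def prev_def numeral_fps_const algebra_simps power2_eq_square)
    qed
  qed (simp add: theta_nth)
qed

lemma first_kind_from_ode: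
  fixes a b c :: rat
  assumes ode: "theta (theta (theta S)) - fps_X * (2 * fps_const a * theta (theta (theta S))
      + 3 * fps_const a * theta (theta S)
        + (fps_const a + 2 * fps_const b) * theta S + fps_const b * S)
      + fps_X * (fps_X * (fps_const c * (theta (theta (theta S)) + 3 * theta (theta S) + 3 * theta S + S))) = 0"
  shows "(of_nat n + 1) ^ 3 * S $ Suc n = (2 * of_nat n + 1) * (a * of_nat n ^ 2 + a * of_nat n + b) * S $ n
      - (if n = 0 then 0 else c * of_nat n ^ 3 * S $ (n - 1))"
proof -
  have "(theta (theta (theta S)) - fps_X * (2 * fps_const a * theta (theta (theta S))
      + 3 * fps_const a * theta (theta S)
        + (fps_const a + 2 * fps_const b) * theta S + fps_const b * S)
      + fps_X * (fps_X * (fps_const c * (theta (theta (theta S)) + 3 * theta (theta S) + 3 * theta S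
          + S)))) $ Suc n = 0"
    unfolding ode by simp
  then show ?thesis
    by (cases n) (simp_all add: theta_nth numeral_fps_const algebra_simps power2_eq_square power3_eq_cube)
qed

text \<open>
  In the application \<open>w = - x / D\<close> is the new variable, and \<open>D * theta\<close> acts on series in \<open>w\<close> as \<open>Q\<close> times
  the Euler operator of \<open>w\<close>, so \<open>S1\<close>, \<open>S2\<close>, \<open>S3\<close> are the iterated Euler derivatives of \<open>D * f\<^sup>2\<close>
  with respect to \<open>w\<close>. With \<open>f1 = D * theta f\<close>, the differential equation of \<open>f\<close> expresses each of them, after
  multiplication by a power of \<open>Q\<close>, as a combination of \<open>f\<^sup>2\<close>, \<open>f * f1\<close> and \<open>f1\<^sup>2\<close> whose coefficients are
  polynomials in \<open>x\<close>. The third order equation claimed here holds because the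
  coefficients of these three products cancel separately (\<open>c1\<close>, \<open>c2\<close>, \<open>c3\<close>).
\<close>

lemma symmetric_square_ode:
  fixes f g a b l D :: "rat fps" and S0 S1 S2 S3 :: "rat fps"
  assumes const: "theta a = 0" "theta b = 0" "theta l = 0"
  defines "D \<equiv> 1 - a * fps_X + b * fps_X * fps_X"
  defines "Q \<equiv> 1 - b * fps_X * fps_X"
  assumes ode: "theta (D * theta f) = (l * fps_X - b * fps_X * fps_X) * f"
    and S0: "S0 = D * (f * f)"
    and S1: "Q * S1 = D * theta S0" and S2: "Q * S2 = D * theta S1" and S3: "Q * S3 = D * theta S2"
  shows "Q * Q * S3 + (3 * a * fps_X * D + 3 * (a * a - 4 * b) * fps_X * fps_X) * S2
     + ((a + 2 * (a - 2 * l)) * fps_X * D + 3 * (a * a - 4 * b) * fps_X * fps_X) * S1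
     + ((a - 2 * l) * fps_X * D + (a * a - 4 * b) * fps_X * fps_X) * S0 = 0"
proof -
  define X :: "rat fps" where "X = fps_X"
  define f1 E E' L Q' where "f1 = D * theta f" and "E = 2 * b * X * X - a * X"
    and "E' = 4 * b * X * X - a * X" and "L = l * X - b * X * X" and "Q' = - 2 * b * X * X"
  have D: "D = 1 - a * X + b * X * X" and Q: "Q = 1 - b * X * X" by (simp_all add: D_def Q_def X_def)
  have thD: "theta D = E" unfolding D E_def X_def by (simp add: const algebra_simps)
  have thE: "theta E = E'" unfolding E_def E'_def X_def by (simp add: const algebra_simps)
  have thE': "theta E' = 8 * b * X * X - a * X" unfolding E'_def X_def by (simp add: const algebra_simps)
  have thQ: "theta Q = Q'" unfolding Q Q'_def X_def by (simp add: const algebra_simps)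
  have thQ': "theta Q' = - 4 * b * X * X" unfolding Q'_def X_def by (simp add: const algebra_simps)
  have thL: "theta L = l * X - 2 * b * X * X" unfolding L_def X_def by (simp add: const algebra_simps)
  have thf: "D * theta f = f1" by (simp add: f1_def)
  have thf1: "theta f1 = L * f" using ode by (simp add: f1_def L_def X_def)
  define P1 where "P1 = E * (f * f) + 2 * (f * f1)"
  have "theta S0 = E * (f * f) + 2 * (f * (D * theta f))"
    unfolding S0 by (simp add: thD algebra_simps)
  then have Q1: "Q * S1 = D * P1" unfolding S1 thf P1_def by simp
  have "D * theta P1 = D * E' * (f * f) + 2 * E * f * (D * theta f) + 2 * (D * theta f) * f1
      + 2 * D * f * (theta f1)"
    unfolding P1_def by (simp add: thE algebra_simps)
  then have thP1: "D * theta P1 = D * E' * (f * f) + 2 * E * (f * f1) + 2 * (f1 * f1) + 2 * D * L * (f * f)"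
    unfolding thf thf1 by (simp add: algebra_simps)
  define p q r where "p = Q * (E * E + D * E' + 2 * D * L) - Q' * D * E"
    and "q = 4 * Q * E - 2 * Q' * D" and "r = 2 * Q"
  define P2 where "P2 = p * (f * f) + q * (f * f1) + r * (f1 * f1)"
  have Q2: "Q * Q * Q * S2 = D * P2"
  proof -
    have "Q * theta S1 + Q' * S1 = E * P1 + D * theta P1"
      using arg_cong[OF Q1, of theta] by (simp add: thQ thD algebra_simps)
    then have s1: "Q * theta S1 = E * P1 + D * theta P1 - Q' * S1" by (simp add: algebra_simps)
    have "Q * Q * Q * S2 = Q * D * (Q * theta S1)"
      using S2 by (simp add: mult_ac)
    also have "\<dots> = D * (Q * (E * P1 + D * theta P1) - Q' * (Q * S1))"
      unfolding s1 by (simp add: algebra_simps)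
    also have "\<dots> = D * P2"
      unfolding Q1 thP1 unfolding P2_def P1_def p_def q_def r_def by (simp add: algebra_simps)
    finally show ?thesis .
  qed
  define p' q' r' where "p' = Q' * (E * E + D * E' + 2 * D * L)
      + Q * (2 * E * E' + E * E' + D * (8 * b * X * X - a * X) + 2 * E * L + 2 * D * (l * X - 2 * b * X * X))
      - (- 4 * b * X * X) * D * E - Q' * E * E - Q' * D * E'"
    and "q' = 4 * Q' * E + 4 * Q * E' - 2 * (- 4 * b * X * X) * D - 2 * Q' * E" and "r' = 2 * Q'"
  have pqr: "theta p = p'" "theta q = q'" "theta r = r'"
    unfolding p_def q_def r_def p'_def q'_def r'_def
    by (simp_all add: thE thE' thQ thQ' thD thL algebra_simps)
  have "D * theta P2 = D * p' * (f * f) + 2 * p * f * (D * theta f) + D * q' * (f * f1) + q * (D * theta f) * f1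
      + q * D * f * theta f1 + D * r' * (f1 * f1) + 2 * r * D * f1 * theta f1"
    unfolding P2_def by (simp add: pqr algebra_simps)
  then have thP2: "D * theta P2 = D * p' * (f * f) + 2 * p * (f * f1) + D * q' * (f * f1) + q * (f1 * f1)
      + q * D * L * (f * f) + D * r' * (f1 * f1) + 2 * r * D * L * (f * f1)"
    unfolding thf thf1 by (simp add: mult_ac)
  have Q3: "Q * Q * Q * (Q * Q * S3) = D * (Q * (E * P2 + D * theta P2) - 3 * Q' * D * P2)"
  proof -
    have "Q * Q * Q * theta S2 + 3 * Q * Q * Q' * S2 = E * P2 + D * theta P2"
      using arg_cong[OF Q2, of theta] by (simp add: thQ thD algebra_simps)
    then have s2: "Q * Q * Q * theta S2 = E * P2 + D * theta P2 - 3 * Q * Q * Q' * S2"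
        by (simp add: algebra_simps)
    have "Q * Q * Q * (Q * Q * S3) = Q * D * (Q * Q * Q * theta S2)"
      using S3 by (simp add: mult_ac)
    also have "\<dots> = D * (Q * (E * P2 + D * theta P2) - 3 * Q' * (Q * Q * Q * S2))"
      unfolding s2 by (simp add: algebra_simps)
    finally show ?thesis unfolding Q2 by (simp add: algebra_simps)
  qed
  define al be ga where "al = 3 * a * X * D + 3 * (a * a - 4 * b) * X * X"
    and "be = (a + 2 * (a - 2 * l)) * X * D + 3 * (a * a - 4 * b) * X * X"
    and "ga = (a - 2 * l) * X * D + (a * a - 4 * b) * X * X"
  have c1: "Q * (E * p + D * p' + q * D * L) - 3 * Q' * D * p + al * p + be * (Q * Q) * E + ga * (Q * Q * Q)
      = 0"
    unfolding al_def be_def ga_def p_def q_def r_def p'_def q'_def r'_def E_def E'_def L_def Q'_def D Q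
    by Groebner_Basis.algebra
  have c2: "Q * (E * q + 2 * p + D * q' + 2 * r * D * L) - 3 * Q' * D * q + al * q + 2 * be * (Q * Q) = 0"
    unfolding al_def be_def ga_def p_def q_def r_def p'_def q'_def r'_def E_def E'_def L_def Q'_def D Q
    by Groebner_Basis.algebra
  have c3: "Q * (E * r + q + D * r') - 3 * Q' * D * r + al * r = 0"
    unfolding al_def be_def ga_def p_def q_def r_def p'_def q'_def r'_def E_def E'_def L_def Q'_def D Q
    by Groebner_Basis.algebra
  have "Q * Q * Q * (Q * Q * S3 + al * S2 + be * S1 + ga * S0)
      = Q * Q * Q * (Q * Q * S3) + al * (Q * Q * Q * S2) + be * (Q * Q) * (Q * S1) + ga * (Q * Q * Q) * S0"
    by (simp add: algebra_simps)
  also have "\<dots> = D * ((Q * (E * p + D * p' + q * D * L) - 3 * Q' * D * p + al * p + be * (Q * Q) * E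
      + ga * (Q * Q * Q)) * (f * f)
      + (Q * (E * q + 2 * p + D * q' + 2 * r * D * L) - 3 * Q' * D * q + al * q + 2 * be * (Q * Q)) * (f * f1)
      + (Q * (E * r + q + D * r') - 3 * Q' * D * r + al * r) * (f1 * f1))"
    unfolding Q3 Q2 Q1 S0 thP2 by (simp add: P1_def P2_def algebra_simps)
  also have "\<dots> = 0" unfolding c1 c2 c3 by simp
  finally have "Q * Q * Q * (Q * Q * S3 + al * S2 + be * S1 + ga * S0) = 0" .
  moreover have "Q $ 0 \<noteq> 0" by (simp add: Q X_def)
  then have "Q \<noteq> 0" by auto
  ultimately show ?thesis by (simp add: al_def be_def ga_def X_def)
qed

lemma second_kind_ode_factored:
  fixes A B l :: int
  assumes u: "second_kind_rec (A, B, l) u"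
  defines "a \<equiv> fps_const (of_int A)" and "b \<equiv> fps_const (of_int B)" and "c \<equiv> fps_const (of_int l)"
    and "f \<equiv> int_series u"
  shows "theta ((1 - a * fps_X + b * fps_X * fps_X) * theta f) = (c * fps_X - b * fps_X * fps_X) * f"
proof -
  have const: "theta a = 0" "theta b = 0" by (simp_all add: a_def b_def)
  have "theta (theta f) = fps_X * (a * (theta (theta f) + theta f) + c * f)
           - fps_X * (fps_X * (b * (theta (theta f) + 2 * theta f + f)))"
    unfolding a_def b_def c_def f_def by (rule second_kind_ode[OF u])
  then show ?thesis by (simp add: const algebra_simps)
qed

lemma first_kind_coeffs_unique:
  fixes a b c :: int
  assumes t: "first_kind_rec (a, b, c, 0) t" and "S $ 0 = 1"
    and S: "\<And>n. (of_nat n + 1) ^ 3 * S $ Suc n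
        = (2 * of_nat n + 1) * (of_int a * of_nat n ^ 2 + of_int a * of_nat n + of_int b) * S $ n
          - (if n = 0 then 0 else of_int c * of_nat n ^ 3 * S $ (n - 1))"
  shows "S = int_series t"
proof (rule fps_ext)
  fix n
  show "S $ n = int_series t $ n"
  proof (induction n rule: less_induct)
    case (less n)
    show ?case
    proof (cases n)
      case 0
      then show ?thesis using assms by (simp add: first_kind_rec_def)
    next
      case (Suc m)
      have "rat_of_int ((int m + 1) ^ 3 * t (Suc m)) = of_int ((2 * int m + 1)
          * (a * int m ^ 2 + a * int m + b) * t m
          - c * int m ^ 3 * prev t m)"
      proof (rule arg_cong[where f = rat_of_int])
        show "(int m + 1) ^ 3 * t (Suc m) = (2 * int m + 1) * (a * int m ^ 2 + a * int m + b) * t m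
          - c * int m ^ 3 * prev t m"
          using t by (simp add: first_kind_rec_def algebra_simps power2_eq_square power3_eq_cube)
      qed
      then have "(of_nat m + 1) ^ 3 * of_int (t (Suc m)) = (of_nat m + 1) ^ 3 * S $ Suc m"
        using less[of m] less[of "m - 1"] Suc by (auto simp: S prev_def)
      moreover have "(of_nat m + 1 :: rat) \<noteq> 0" by (simp add: add_nonneg_eq_0_iff)
      ultimately show ?thesis using Suc by simp
    qed
  qed
qed

text \<open>
  This is the transformation of Almkvist, van Straten and Zudilin. The series \<open>S\<close> with \<open>S(w) = D * U\<^sup>2\<close>
  exists because \<open>w\<close> has a compositional inverse. By the chain rule and \<open>symmetric_square_ode\<close> it satisfies the differential
  equation that encodes the recurrence of the first kind, and the recurrence determines the coefficients.
\<close>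

theorem quadratic_transformation:
  fixes A B l :: int
  assumes u: "second_kind_rec (A, B, l) u"
    and t: "first_kind_rec (A, A - 2 * l, A\<^sup>2 - 4 * B, 0) t"
  defines "D \<equiv> 1 - fps_const (of_int A) * fps_X + fps_const (of_int B) * fps_X * fps_X"
  shows "int_series t oo (- fps_X * inverse D) = D * (int_series u * int_series u)"
proof -
  define X :: "rat fps" where "X = fps_X"
  define a b c f where "a = fps_const (rat_of_int A)" and "b = fps_const (rat_of_int B)"
    and "c = fps_const (rat_of_int l)" and "f = int_series u"
  have const: "theta a = 0" "theta b = 0" "theta c = 0" by (simp_all add: a_def b_def c_def)
  have D: "D = 1 - a * X + b * X * X" by (simp add: D_def a_def b_def X_def)
  define w where "w = - X * inverse D"
  have D0: "D $ 0 = 1" by (simp add: D_def)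
  have wD: "w * D = - X" unfolding w_def using inverse_mult_eq_1[of D] D0 by (simp add: mult.assoc)
  have w0: "w $ 0 = 0" by (simp add: w_def X_def)
  have w1: "w $ 1 \<noteq> 0" using D0 by (simp add: w_def X_def fps_mult_nth_1)
  have w_nz: "w \<noteq> 0" using w1 by auto
  define S where "S = (D * (f * f)) oo fps_inv w"
  have Sw: "S oo w = D * (f * f)"
    unfolding S_def using fps_inv[OF w0 w1]
    by (subst fps_compose_assoc[symmetric]) (simp_all add: w0 fps_inv_def)
  define Q where "Q = 1 - b * X * X"
  have chain: "Q * (theta g oo w) = D * theta (g oo w)" for g
  proof -
    have "theta (w * D) = - X" unfolding wD by (simp add: X_def)
    then have "D * theta w = - X - w * (2 * b * X * X - a * X)"
      by (simp add: D X_def const algebra_simps)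
    also have "\<dots> = w * Q" unfolding wD[symmetric] by (simp add: D Q_def algebra_simps)
    finally have "D * theta w = w * Q" .
    moreover have "w * (D * theta (g oo w)) = (theta g oo w) * (D * theta w)"
      using theta_compose[OF w0, of g] by (simp add: mult_ac)
    ultimately have "w * (D * theta (g oo w)) = w * (Q * (theta g oo w))"
      by (simp add: mult_ac)
    then show ?thesis using w_nz by simp
  qed
  define S1 S2 S3 where "S1 = theta S oo w" and "S2 = theta (theta S) oo w" and "S3
      = theta (theta (theta S)) oo w"
  have ode: "Q * Q * S3 + (3 * a * X * D + 3 * (a * a - 4 * b) * X * X) * S2
     + ((a + 2 * (a - 2 * c)) * X * D + 3 * (a * a - 4 * b) * X * X) * S1
     + ((a - 2 * c) * X * D + (a * a - 4 * b) * X * X) * (S oo w) = 0"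
    unfolding D Q_def X_def
  proof (rule symmetric_square_ode[OF const])
    show "theta ((1 - a * fps_X + b * fps_X * fps_X) * theta f) = (c * fps_X - b * fps_X * fps_X) * f"
      unfolding a_def b_def c_def f_def by (rule second_kind_ode_factored[OF u])
  qed (use chain Sw in \<open>simp_all add: S1_def S2_def S3_def D Q_def X_def\<close>)
  define a' c' where "a' = a - 2 * c" and "c' = a * a - 4 * b"
  \<comment> \<open>\<open>OP = 0\<close> is the differential equation of the first kind for \<open>S\<close>; it is tested after composition with \<open>w\<close>\<close>
  define OP where "OP = theta (theta (theta S)) - X * (2 * a * theta (theta (theta S)) + 3 * a * theta (theta S)
        + (a + 2 * a') * theta S + a' * S)
      + X * (X * (c' * (theta (theta (theta S)) + 3 * theta (theta S) + 3 * theta S + S)))"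
  have cc: "a oo w = a" "a' oo w = a'" "c' oo w = c'" "X oo w = w" "numeral k oo w = numeral k" for k
    by (simp_all add: a_def a'_def c'_def b_def c_def X_def numeral_fps_const fps_compose_sub_distrib
        fps_compose_mult_distrib w0)
  have "OP oo w = S3 - w * (2 * a * S3 + 3 * a * S2 + (a + 2 * a') * S1 + a' * (S oo w))
      + w * (w * (c' * (S3 + 3 * S2 + 3 * S1 + (S oo w))))"
    unfolding OP_def S1_def S2_def S3_def
    by (simp add: fps_compose_add_distrib fps_compose_sub_distrib fps_compose_mult_distrib w0 cc)
  \<comment> \<open>by \<open>w * D = - X\<close>, multiplication by \<open>D\<^sup>2\<close> turns this into \<open>ode\<close>\<close>
  then have "D * D * (OP oo w) = D * D * (S3 - w * (2 * a * S3 + 3 * a * S2 + (a + 2 * a') * S1 + a' * (S oo w))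
      + w * (w * (c' * (S3 + 3 * S2 + 3 * S1 + (S oo w)))))"
    by (rule arg_cong)
  also have "\<dots> = D * D * S3 - (w * D) * D * (2 * a * S3 + 3 * a * S2 + (a + 2 * a') * S1 + a' * (S oo w))
      + (w * D) * (w * D) * (c' * (S3 + 3 * S2 + 3 * S1 + (S oo w)))"
    by (simp add: algebra_simps)
  also have "\<dots> = Q * Q * S3 + (3 * a * X * D + 3 * (a * a - 4 * b) * X * X) * S2
     + ((a + 2 * (a - 2 * c)) * X * D + 3 * (a * a - 4 * b) * X * X) * S1
     + ((a - 2 * c) * X * D + (a * a - 4 * b) * X * X) * (S oo w)"
  proof -
    have "D * D + 2 * a * X * D + (a * a - 4 * b) * X * X = Q * Q"
      unfolding D Q_def by Groebner_Basis.algebra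
    then show ?thesis unfolding wD a'_def c'_def by Groebner_Basis.algebra
  qed
  also have "\<dots> = 0" by (rule ode)
  finally have "OP oo w = 0" using D0 by auto
  then have "OP = 0" using fps_compose_eq_0_imp[OF w0 w1] by blast
  moreover have "a' = fps_const (of_int (A - 2 * l))" "c' = fps_const (of_int (A\<^sup>2 - 4 * B))"
    by (simp_all add: a'_def c'_def a_def b_def c_def numeral_fps_const power2_eq_square)
  ultimately have "(of_nat n + 1) ^ 3 * S $ Suc n
        = (2 * of_nat n + 1) * (of_int A * of_nat n ^ 2 + of_int A * of_nat n + of_int (A - 2 * l)) * S $ n
          - (if n = 0 then 0 else of_int (A\<^sup>2 - 4 * B) * of_nat n ^ 3 * S $ (n - 1))" for n
    using first_kind_from_ode[where a = "of_int A" and b = "of_int (A - 2 * l)" and c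
        = "of_int (A\<^sup>2 - 4 * B)" and S = S and n = n]
    by (simp only: OP_def X_def a_def)
  moreover have "S $ 0 = 1"
    using u D0 by (simp add: S_def f_def second_kind_rec_def)
  ultimately have "S = int_series t"
    using first_kind_coeffs_unique[OF t] by blast
  then show ?thesis using Sw by (simp add: w_def X_def f_def)
qed

section \<open>Transport of congruences along the transformation\<close>

definition int_fps :: "rat fps \<Rightarrow> bool" where
  "int_fps f \<longleftrightarrow> (\<forall>n. f $ n \<in> \<int>)"

lemma int_fps_intros:
  "int_fps (int_series u)" "int_fps 1" "int_fps (numeral k)" "int_fps fps_X" "int_fps (fps_const (of_int z))"
  "int_fps f \<Longrightarrow> int_fps g \<Longrightarrow> int_fps (f + g)"
  "int_fps f \<Longrightarrow> int_fps g \<Longrightarrow> int_fps (f - g)"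
  "int_fps f \<Longrightarrow> int_fps (- f)"
  "int_fps f \<Longrightarrow> int_fps g \<Longrightarrow> int_fps (f * g)"
  by (auto simp: int_fps_def fps_mult_nth numeral_fps_const intro!: Ints_sum)

lemma int_fps_power: "int_fps f \<Longrightarrow> int_fps (f ^ n)"
  by (induction n) (auto intro: int_fps_intros)

lemma int_fps_inverse:
  assumes "int_fps f" "f $ 0 = 1"
  shows "int_fps (inverse f)"
  unfolding int_fps_def
proof
  fix n
  show "inverse f $ n \<in> \<int>"
  proof (induction n rule: less_induct)
    case (less n)
    show ?case
    proof (cases "n = 0")
      case False
      have "(f * inverse f) $ n = 0"
        using False assms(2) by (simp add: inverse_mult_eq_1')
      then have "inverse f $ n = - (\<Sum>i=1..n. f $ i * inverse f $ (n - i))"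
        using assms(2) by (simp add: fps_mult_nth sum.atLeast_Suc_atMost eq_neg_iff_add_eq_0)
      also have "\<dots> \<in> \<int>"
        using assms(1) less False by (intro Ints_minus Ints_sum Ints_mult) (auto simp: int_fps_def)
      finally show ?thesis .
    qed (use assms in simp)
  qed
qed

text \<open>
  Let \<open>g = 1 / (1 - l * x)\<close> and \<open>G(y) = 1 / (1 - (A - 2 * l) * y)\<close> be the two geometric series. Then
  \<open>G(w) = D / R\<close> with \<open>R = 1 - 2 * l * x + B * x\<^sup>2\<close>, and \<open>R\<close> is congruent to \<open>1 / g\<^sup>2\<close> modulo \<open>m\<close>, so
  \<open>T(w) = D * U\<^sup>2\<close> is congruent to \<open>D * g\<^sup>2\<close> and hence to \<open>G(w)\<close>. Since \<open>w\<close> begins with \<open>- x\<close>, the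
  congruence passes from \<open>(T - G)(w)\<close> to \<open>T - G\<close>, one coefficient after the other.
\<close>

theorem first_kind_cong_from_second_kind:
  fixes A B l m :: int
  assumes u: "second_kind_rec (A, B, l) u"
    and t: "first_kind_rec (A, A - 2 * l, A\<^sup>2 - 4 * B, 0) t"
    and cong: "\<And>n. [u n = l ^ n] (mod m)" and B: "[B = l\<^sup>2] (mod m)"
  shows "[t n = (A - 2 * l) ^ n] (mod m)"
proof -
  define X :: "rat fps" where "X = fps_X"
  define a b c where "a = fps_const (rat_of_int A)" and "b = fps_const (rat_of_int B)"
    and "c = fps_const (rat_of_int l)"
  define \<mu> where "\<mu> = fps_const (rat_of_int m)"
  define D w where "D = 1 - a * X + b * X * X" and "w = - X * inverse D"
  note ints = int_fps_intros[folded X_def]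
  have D0: "D $ 0 = 1" by (simp add: D_def X_def)
  have w0: "w $ 0 = 0" by (simp add: w_def X_def)
  have int_const: "int_fps a" "int_fps b" "int_fps c" by (auto simp: a_def b_def c_def intro: ints)
  have intD: "int_fps D" unfolding D_def by (intro ints int_const)
  have intw: "int_fps w" unfolding w_def by (intro ints int_fps_inverse intD D0)
  have T: "int_series t oo w = D * (int_series u * int_series u)"
    using quadratic_transformation[OF u t] unfolding D_def w_def a_def b_def X_def by simp
  have geometric: "int_series (\<lambda>n. z ^ n) * (1 - fps_const (of_int z) * X) = 1" for z
    by (rule fps_ext) (auto simp: X_def int_series_def algebra_simps gr0_conv_Suc mult.left_commute[of _ fps_X])
  define g where "g = int_series (\<lambda>n. l ^ n)"
  have g: "g * (1 - c * X) = 1" unfolding g_def c_def by (rule geometric)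
  define G where "G = int_series (\<lambda>n. (A - 2 * l) ^ n)"
  define R where "R = 1 - 2 * c * X + b * X * X"
  have R0: "R $ 0 = 1" by (simp add: R_def X_def)
  have intR: "int_fps R" using int_const unfolding R_def by (intro ints)
  have GR: "(G oo w) * R = D"
  proof -
    have wD: "w * D = - X" unfolding w_def using inverse_mult_eq_1[of D] D0 by (simp add: mult.assoc)
    have "(G * (1 - fps_const (of_int (A - 2 * l)) * X)) oo w = 1"
      unfolding G_def geometric by simp
    then have "(G oo w) * (1 - (a - 2 * c) * w) = 1"
      by (simp add: fps_compose_mult_distrib fps_compose_sub_distrib w0 X_def a_def c_def numeral_fps_const)
    moreover have "(G oo w) * (D - (a - 2 * c) * (w * D)) = ((G oo w) * (1 - (a - 2 * c) * w)) * D"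
      by (simp add: algebra_simps)
    ultimately have "(G oo w) * (D - (a - 2 * c) * (w * D)) = D"
      by simp
    then show ?thesis unfolding wD by (simp add: D_def R_def algebra_simps)
  qed
  obtain h where h: "int_series u = g + \<mu> * int_series h"
  proof -
    have "\<forall>n. \<exists>z. u n = l ^ n + m * z"
      using cong by (metis cong_iff_lin cong_sym mult.commute)
    then obtain h where "\<And>n. u n = l ^ n + m * h n" by metis
    then have "int_series u = g + \<mu> * int_series h"
      by (intro fps_ext) (simp add: g_def \<mu>_def)
    then show ?thesis by (rule that)
  qed
  obtain z where z: "B = l\<^sup>2 + m * z"
    using B by (metis cong_iff_lin cong_sym mult.commute)
  have bz: "b = c * c + \<mu> * fps_const (of_int z)"
    unfolding b_def c_def \<mu>_def z by (simp add: power2_eq_square)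
  define K where "K = D * (2 * g * int_series h + \<mu> * int_series h * int_series h)
      + D * inverse R * g * g * fps_const (of_int z) * X * X"
  have "int_fps K"
    unfolding K_def \<mu>_def g_def by (intro ints intD int_fps_inverse intR R0)
  have key: "(int_series t - G) oo w = \<mu> * K"
  proof -
    have iR: "R * inverse R = 1" using R0 by (simp add: inverse_mult_eq_1')
    have Gw: "G oo w = D * inverse R"
      using GR iR by (metis mult.assoc mult_1_right)
    have "R = (1 - c * X) * (1 - c * X) + \<mu> * fps_const (of_int z) * X * X"
      unfolding R_def bz by (simp add: algebra_simps)
    then have "g * g * R = g * g * ((1 - c * X) * (1 - c * X) + \<mu> * fps_const (of_int z) * X * X)"
      by (rule arg_cong)
    then have "g * g * R = (g * (1 - c * X)) * (g * (1 - c * X)) + \<mu> * (g * g * fps_const (of_int z) * X * X)"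
      by (simp only: distrib_left mult_ac)
    then have "g * g * R = 1 + \<mu> * (g * g * fps_const (of_int z) * X * X)"
      unfolding g by simp
    then have "g * g * (R * inverse R) = (1 + \<mu> * (g * g * fps_const (of_int z) * X * X)) * inverse R"
      by (simp only: mult.assoc[symmetric])
    then have gg: "g * g = inverse R + \<mu> * (inverse R * g * g * fps_const (of_int z) * X * X)"
      unfolding iR by (simp add: algebra_simps)
    have "(int_series t - G) oo w = D * (g * g) + \<mu> * (D * (2 * g * int_series h
        + \<mu> * int_series h * int_series h)) - D * inverse R"
      unfolding fps_compose_sub_distrib T Gw h by (simp add: algebra_simps)
    also have "\<dots> = \<mu> * K"
      by (subst gg) (simp add: K_def algebra_simps)
    finally show ?thesis .
  qed
  have "m dvd t n - (A - 2 * l) ^ n"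
  proof (induction n rule: less_induct)
    case (less n)
    define E where "E i = t i - (A - 2 * l) ^ i" for i
    have E: "(int_series t - G) $ i = of_int (E i)" for i by (simp add: G_def E_def)
    have "\<forall>i. \<exists>z. (w ^ i) $ n = of_int z"
      using int_fps_power[OF intw] unfolding int_fps_def by (blast elim: Ints_cases)
    from choice[OF this] obtain W where W: "\<forall>i. (w ^ i) $ n = of_int (W i)" ..
    have "K $ n \<in> \<int>" using \<open>int_fps K\<close> by (simp add: int_fps_def)
    then obtain k where k: "K $ n = of_int k" by (rule Ints_cases)
    have "((int_series t - G) oo w) $ n = (\<Sum>i=0..n. of_int (E i) * of_int (W i))"
      unfolding fps_compose_nth E using W by simp
    then have "rat_of_int (m * k) = of_int (\<Sum>i=0..n. E i * W i)"
      unfolding key by (simp add: \<mu>_def k)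
    then have mk: "m * k = (\<Sum>i=0..n. E i * W i)" by (simp only: of_int_eq_iff)
    have "w ^ n = (- 1) ^ n * (X ^ n * inverse D ^ n)"
      unfolding w_def by (simp add: power_mult_distrib[symmetric] mult.assoc[symmetric])
    moreover have "(X ^ n * inverse D ^ n) $ n = 1"
      using D0 by (simp add: X_def fps_X_power_mult_nth fps_power_zeroth)
    moreover have "((- 1) ^ n * F) $ n = (- 1) ^ n * F $ n" for F :: "rat fps"
      by (cases "even n") simp_all
    ultimately have "(w ^ n) $ n = (- 1) ^ n" by (simp only: mult_1_right)
    then have "rat_of_int (W n) = of_int ((- 1) ^ n)" using W by simp
    then have Wn: "W n = (- 1) ^ n" by (simp only: of_int_eq_iff)
    have "m dvd (\<Sum>i<n. E i * W i)"
      using less by (intro dvd_sum dvd_mult2) (auto simp: E_def)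
    moreover have "(\<Sum>i=0..n. E i * W i) = (\<Sum>i<n. E i * W i) + E n * (- 1) ^ n"
      using Wn by (simp add: atLeast0AtMost lessThan_Suc_atMost[symmetric])
    ultimately have "m dvd E n * (- 1) ^ n"
      using mk dvd_triv_left[of m k] by (simp add: dvd_add_right_iff)
    then show ?case by (cases "even n") (simp_all add: E_def dvd_diff_commute)
  qed
  then show ?thesis by (simp add: cong_iff_dvd_diff)
qed

section \<open>Squarefree divisors and the gcd of the binomial transforms\<close>

lemma squarefree_dvd_power_imp_dvd:
  fixes d m :: "'a :: factorial_semiring"
  assumes "squarefree d" "d dvd m ^ k"
  shows "d dvd m"
proof (cases "m = 0")
  case False
  have d: "d \<noteq> 0" using assms(1) by auto
  show ?thesis
  proof (rule multiplicity_le_imp_dvd[OF d])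
    fix p :: 'a assume p: "prime p"
    show "multiplicity p d \<le> multiplicity p m"
    proof (cases "p dvd d")
      case True
      then have "p dvd m ^ k" using assms(2) by (rule dvd_trans)
      then have "p dvd m" using p prime_dvd_power by blast
      then have "1 \<le> multiplicity p m" using p False by (simp add: multiplicity_gt_zero_iff Suc_leI)
      moreover have "multiplicity p d \<le> 1"
      proof (rule ccontr)
        assume "\<not> multiplicity p d \<le> 1"
        then have "p ^ 2 dvd d" by (intro multiplicity_dvd') simp
        then show False using assms(1) p by (auto dest: squarefreeD)
      qed
      ultimately show ?thesis by simp
    qed (simp add: not_dvd_imp_multiplicity_0)
  qed
qed simp

lemma squarefree_divisor_properties:
  assumes "M \<noteq> 0"
  shows "squarefree_divisor M dvd M" "squarefree (squarefree_divisor M)"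
proof -
  have "finite {d. d dvd M \<and> squarefree d}"
    using finite_divisors_int[OF assms] by (rule rev_finite_subset) auto
  moreover have "{d. d dvd M \<and> squarefree d} \<noteq> {}"
    using one_dvd squarefree_1 by blast
  ultimately have "squarefree_divisor M \<in> {d. d dvd M \<and> squarefree d}"
    unfolding squarefree_divisor_def by (rule Max_in)
  then show "squarefree_divisor M dvd M" "squarefree (squarefree_divisor M)" by auto
qed

text \<open>
  As \<open>\<alpha>\<close> is congruent to \<open>l\<close> modulo the gcd \<open>M\<close>, the terms \<open>v\<^sub>2(l) = u 2 - l\<^sup>2\<close> and
  \<open>v\<^sub>3(l) = u 3 - 3 * l * u 2 + 2 * l ^ 3\<close> are multiples of \<open>M\<close>, and with them their combination \<open>g\<close>.
  A squarefree divisor of \<open>g\<close> divides \<open>N\<close> as soon as \<open>g\<close> divides a power of \<open>N\<close>; the exponent 3 suffices because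
  \<open>g\<close> will be a divisor of \<open>2 ^ 3\<close>, \<open>6 ^ 3\<close> or \<open>10 ^ 3\<close>.
\<close>

lemma cong_mod_squarefree_divisor:
  fixes u :: "nat \<Rightarrow> int"
  assumes u: "u 0 = 1" "u 1 = l" "\<And>n. [u n = l ^ n] (mod N)"
    and g: "g = x * (u 2 - l\<^sup>2) + y * (u 3 - 3 * l * u 2 + 2 * l ^ 3)" "g \<noteq> 0" "g dvd N ^ 3"
    and I: "{1..3} \<subseteq> I"
  shows "[u n = \<alpha> ^ n] (mod squarefree_divisor (Gcd (binomial_transform u \<alpha> ` I)))"
proof -
  define M where "M = Gcd (binomial_transform u \<alpha> ` I)"
  have dvd: "M dvd binomial_transform u \<alpha> i" if "i \<in> {1..3}" for i
    unfolding M_def using that I by (intro Gcd_dvd) auto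
  have "binomial_transform u \<alpha> 1 = l - \<alpha>"
    using u by (simp add: binomial_transform_def)
  then have l: "[l = \<alpha>] (mod M)" using dvd[of 1] by (simp add: cong_iff_dvd_diff)
  have dvd_l: "M dvd binomial_transform u l i" if "i \<in> {1..3}" for i
  proof -
    have "[binomial_transform u l i = binomial_transform u \<alpha> i] (mod M)"
      unfolding binomial_transform_def
      by (intro cong_sum cong_mult cong_pow cong_refl) (use l in \<open>simp add: cong_minus_minus_iff\<close>)
    then show ?thesis using dvd[OF that] cong_dvd_iff by blast
  qed
  have v: "binomial_transform u l 2 = u 2 - l\<^sup>2"
    "binomial_transform u l 3 = u 3 - 3 * l * u 2 + 2 * l ^ 3"
    using u by (simp_all add: binomial_transform_def eval_nat_numeral algebra_simps)
  have M_dvd: "M dvd u 2 - l\<^sup>2" "M dvd u 3 - 3 * l * u 2 + 2 * l ^ 3"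
    unfolding v[symmetric] by (rule dvd_l; simp)+
  have Mg: "M dvd g"
    unfolding g(1) by (rule dvd_add[OF dvd_mult[OF M_dvd(1)] dvd_mult[OF M_dvd(2)]])
  then have "M \<noteq> 0" using g(2) by auto
  define d where "d = squarefree_divisor M"
  note d = squarefree_divisor_properties[OF \<open>M \<noteq> 0\<close>, folded d_def]
  have "d dvd N"
    using squarefree_dvd_power_imp_dvd[OF d(2)] dvd_trans[OF d(1) dvd_trans[OF Mg g(3)]] by blast
  then have "[u n = l ^ n] (mod d)" using u(3) cong_dvd_modulus by blast
  also have "[l ^ n = \<alpha> ^ n] (mod d)"
    using l d(1) by (intro cong_pow) (rule cong_dvd_modulus)
  finally show ?thesis by (simp add: d_def M_def)
qed

text \<open>
  Here \<open>w\<close> and \<open>z\<close> are the values \<open>u 2\<close> and \<open>u 3\<close>, which the recurrence determines; \<open>v\<close> is the same sequence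
  in a form in which the congruence is known.
\<close>

lemma second_kind_case:
  assumes u: "second_kind_rec (A, B, l) u" and v: "second_kind_rec (A, B, l) v"
    and cong: "\<And>n. [v n = l ^ n] (mod N)"
    and vals: "4 * w = (2 * A + l) * l - B" "9 * z = (6 * A + l) * w - 4 * B * l"
    and g: "g = x * (w - l\<^sup>2) + y * (z - 3 * l * w + 2 * l ^ 3)" "g \<noteq> 0" "g dvd N ^ 3"
  shows "[u n = \<alpha> ^ n] (mod squarefree_divisor (apery_M Second_Kind u \<alpha>))"
proof -
  note r = u[unfolded second_kind_rec_iff]
  have u01: "u 0 = 1" "u 1 = l" using r by auto
  have "4 * u 2 = (2 * A + l) * l - B"
    using spec[OF conjunct2[OF conjunct2[OF r]], of 0] u01 by (simp add: eval_nat_numeral)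
  then have u2: "u 2 = w" using vals(1) by simp
  have "9 * u 3 = (6 * A + l) * u 2 - 4 * B * l"
    using spec[OF conjunct2[OF conjunct2[OF r]], of 1] u01 by (simp add: eval_nat_numeral)
  then have u3: "u 3 = z" using vals(2) u2 by simp
  have cong_u: "[u n = l ^ n] (mod N)" for n
    using cong second_kind_rec_unique[OF u v] by simp
  have "g = x * (u 2 - l\<^sup>2) + y * (u 3 - 3 * l * u 2 + 2 * l ^ 3)"
    unfolding u2 u3 by (rule g(1))
  then show ?thesis unfolding apery_M.simps
    by (rule cong_mod_squarefree_divisor[OF u01 cong_u _ g(2,3)]) simp
qed

lemma first_kind_case:
  assumes u: "first_kind_rec (a, b, c, d) u" and v: "first_kind_rec (a, b, c, d) v"
    and cong: "\<And>n. [v n = b ^ n] (mod N)"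
    and vals: "8 * w = 3 * (2 * a + b) * b - (c + d)" "27 * z = 5 * (6 * a + b) * w - 2 * (4 * c + d) * b"
    and g: "g = x * (w - b\<^sup>2) + y * (z - 3 * b * w + 2 * b ^ 3)" "g \<noteq> 0" "g dvd N ^ 3"
  shows "[u n = \<alpha> ^ n] (mod squarefree_divisor (apery_M First_Kind u \<alpha>))"
proof -
  note r = u[unfolded first_kind_rec_iff]
  have u01: "u 0 = 1" "u 1 = b" using r by auto
  have "8 * u 2 = 3 * (2 * a + b) * b - (c + d)"
    using spec[OF conjunct2[OF conjunct2[OF r]], of 0] u01 by (simp add: eval_nat_numeral)
  then have u2: "u 2 = w" using vals(1) by simp
  have "27 * u 3 = 5 * (6 * a + b) * u 2 - 2 * (4 * c + d) * b"
    using spec[OF conjunct2[OF conjunct2[OF r]], of 1] u01 by (simp add: eval_nat_numeral)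
  then have u3: "u 3 = z" using vals(2) u2 by simp
  have cong_u: "[u n = b ^ n] (mod N)" for n
    using cong first_kind_rec_unique[OF u v] by simp
  have "g = x * (u 2 - b\<^sup>2) + y * (u 3 - 3 * b * u 2 + 2 * b ^ 3)"
    unfolding u2 u3 by (rule g(1))
  then show ?thesis unfolding apery_M.simps
    by (rule cong_mod_squarefree_divisor[OF u01 cong_u _ g(2,3)]) simp
qed

section \<open>The fifteen sequences\<close>

text \<open>
  In each case \<open>x\<close> and \<open>y\<close> are the coefficients of a combination \<open>g\<close> of \<open>v\<^sub>2(l)\<close> and \<open>v\<^sub>3(l)\<close> that
  divides \<open>N ^ 3\<close>, often their gcd up to sign.
\<close>

theorem theorem1p1:
  fixes kind :: apery_kind and u :: "nat \<Rightarrow> int" and \<alpha> :: int and n :: nat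
  assumes "apery_like kind u"
  shows "[u n = \<alpha> ^ n] (mod squarefree_divisor (apery_M kind u \<alpha>))"
proof (cases kind)
  case Second_Kind
  with assms obtain p where p: "p \<in> second_kind_params" "second_kind_rec p u" by auto
  from p(1) consider "p = (7, -8, 2)" | "p = (9, 27, 3)" | "p = (10, 9, 3)" | "p = (11, -1, 3)"
    | "p = (12, 32, 4)" | "p = (17, 72, 6)"
    unfolding second_kind_params_def by blast
  then have "[u n = \<alpha> ^ n] (mod squarefree_divisor (apery_M Second_Kind u \<alpha>))"
  proof cases
    case 1
    show ?thesis
      by (rule second_kind_case[OF p(2)[unfolded 1] franel_rec franel_cong,
            where w = 10 and z = 56 and x = 1 and y = 0 and g = 6]) simp_all
  next
    case 2
    show ?thesis
      by (rule second_kind_case[OF p(2)[unfolded 2] zagier_B_rec zagier_B_cong,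
            where w = 9 and z = 21 and x = 0 and y = 1 and g = "-6"]) simp_all
  next
    case 3
    show ?thesis
      by (rule second_kind_case[OF p(2)[unfolded 3] zagier_C_rec zagier_C_cong,
            where w = 15 and z = 93 and x = 1 and y = 0 and g = 6]) simp_all
  next
    case 4
    show ?thesis
      by (rule second_kind_case[OF p(2)[unfolded 4] zagier_D_rec zagier_D_cong,
            where w = 19 and z = 147 and x = 1 and y = 0 and g = 10]) simp_all
  next
    case 5
    show ?thesis
      by (rule second_kind_case[OF p(2)[unfolded 5] zagier_E_rec zagier_E_cong,
            where w = 20 and z = 112 and x = 1 and y = 0 and g = 4]) simp_all
  next
    case 6
    show ?thesis
      by (rule second_kind_case[OF p(2)[unfolded 6] zagier_F_rec zagier_F_cong,
            where w = 42 and z = 312 and x = 1 and y = 0 and g = 6]) simp_all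
  qed
  then show ?thesis by (simp only: Second_Kind)
next
  case First_Kind
  with assms obtain p where p: "p \<in> first_kind_params" "first_kind_rec p u" by auto
  from p(1) consider "p = (7, 3, 81, 0)" | "p = (11, 5, 125, 0)" | "p = (10, 4, 64, 0)"
    | "p = (12, 4, 16, 0)" | "p = (9, 3, -27, 0)" | "p = (17, 5, 1, 0)"
    | "p = (13, 4, -27, 3)" | "p = (6, 2, -64, 4)" | "p = (14, 6, 192, -12)"
    unfolding first_kind_params_def by blast
  then have "[u n = \<alpha> ^ n] (mod squarefree_divisor (apery_M First_Kind u \<alpha>))"
  proof cases
    case 1
    note u = p(2)[unfolded 1]
    have "[u n = 3 ^ n] (mod 6)" for n
      using first_kind_cong_from_second_kind[OF franel_rec _ franel_cong, of u n] u
      by (simp add: cong_def)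
    then show ?thesis
      by (rule first_kind_case[OF u u, where w = 9 and z = 3 and x = 0 and y = 1 and g = "-24"]) simp_all
  next
    case 2
    note u = p(2)[unfolded 2]
    have "[u n = 5 ^ n] (mod 10)" for n
      using first_kind_cong_from_second_kind[OF zagier_D_rec _ zagier_D_cong, of u n] u
      by (simp add: cong_def)
    then show ?thesis
      by (rule first_kind_case[OF u u, where w = 35 and z = 275 and x = 1 and y = 0 and g = 10]) simp_all
  next
    case 3
    note u = p(2)[unfolded 3]
    have "[u n = 4 ^ n] (mod 6)" for n
      using first_kind_cong_from_second_kind[OF zagier_C_rec _ zagier_C_cong, of u n] u
      by (simp add: cong_def)
    then show ?thesis
      by (rule first_kind_case[OF u u, where w = 28 and z = 256 and x = 1 and y = 0 and g = 12]) simp_all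
  next
    case 4
    show ?thesis
      by (rule first_kind_case[OF p(2)[unfolded 4] apery_epsilon_rec apery_epsilon_cong,
            where w = 40 and z = 544 and x = 1 and y = 0 and g = 24]) simp_all
  next
    case 5
    note u = p(2)[unfolded 5]
    have "[u n = 3 ^ n] (mod 6)" for n
      using first_kind_cong_from_second_kind[OF zagier_B_rec _ zagier_B_cong, of u n] u
      by (simp add: cong_def)
    then show ?thesis
      by (rule first_kind_case[OF u u, where w = 27 and z = 309 and x = 7 and y = "-1" and g = 6]) simp_all
  next
    case 6
    note u = p(2)[unfolded 6]
    have "[u n = 5 ^ n] (mod 6)" for n
      using first_kind_cong_from_second_kind[OF zagier_F_rec _ zagier_F_cong, of u n] u
      by (simp add: cong_def)
    then show ?thesis
      by (rule first_kind_case[OF u u, where w = 73 and z = 1445 and x = "-12" and y = 1 and g = 24]) simp_all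
  next
    case 7
    show ?thesis
      by (rule first_kind_case[OF p(2)[unfolded 7] apery_s7_rec apery_s7_cong,
            where w = 48 and z = 760 and x = 10 and y = "-1" and g = 8]) simp_all
  next
    case 8
    show ?thesis
      by (rule first_kind_case[OF p(2)[unfolded 8] apery_s10_rec apery_s10_cong,
            where w = 18 and z = 164 and x = "-5" and y = 1 and g = 2]) simp_all
  next
    case 9
    show ?thesis
      by (rule first_kind_case[OF p(2)[unfolded 9] apery_s18_rec apery_s18_cong,
            where w = 54 and z = 564 and x = 0 and y = 1 and g = 24]) simp_all
  qed
  then show ?thesis by (simp only: First_Kind)
qed

end
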